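(* Let $a,b>0$ with $a\neq b$, let $\Theta\in(0,1)$, and let $g:\mathbb{R}\to\mathbb{R}$ be the $2\pi$-periodic function with $g(x)=a$ for $|x|<\pi\Theta$ and $g(x)=b$ for $\pi\Theta<|x|<\pi$ (on $[-\pi,\pi]$). Assume $\sqrt{b/a}\,\frac{1-\Theta}{\Theta}=\frac{\tilde p}{\tilde q}$ for some positive odd integers $\tilde p,\tilde q$. Let $\gamma\in\mathbb{R}\setminus\{0\}$, $h=\gamma\delta_0$, and let $\omega>0$ be such that $4\sqrt{a}\,\Theta\,\omega=\frac{p}{q}$ for some positive odd integers $p,q$. Then, with $T=\frac{2\pi}{\omega}$, the equation $g(x)w_{tt}-w_{xx}+h(x)(w_t^3)_t=0$ has infinitely many distinct nontrivial, real-valued, $T$-periodic weak solutions $w$, and for each such solution there are constants $C,\rho>0$ with $|w(x,t)|\le Ce^{-\rho|x|}$ for all $(x,t)$.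
   Context: Here $\delta_0$ is the Dirac delta at $x=0$. Let $T=2\pi/\omega$, let $\mathbb{T}_T=\mathbb{R}/T\mathbb{Z}$ be the one-dimensional torus of length $T$, and $D=\mathbb{R}\times\mathbb{T}_T$. For $g\in L^\infty(\mathbb{R})$ and $h=\gamma\delta_0$ with $\gamma\in\mathbb{R}\setminus\{0\}$, a weak solution of $g(x)w_{tt}-w_{xx}+h(x)(w_t^3)_t=0$ is a real function $w\in H^1(D)$ with $\partial_t w(0,\cdot)\in L^3(\mathbb{T}_T)$ such that for every $\psi\in C_c^\infty(D)$ $$\int_D\big(-g(x)\,\partial_tw\,\partial_t\psi+\partial_xw\,\partial_x\psi\big)\,d(x,t)-\gamma\int_0^T(\partial_tw(0,t))^3\,\partial_t\psi(0,t)\,dt=0.$$ *)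

theory Defs
  imports "HOL-Analysis.Analysis"
begin

text \<open>Functions on D = R x T_T are represented as functions real x real => real that are
T-periodic in the second (time) variable; integrals over D are integrals over the
fundamental domain R x [0,T] with respect to Lebesgue measure on R^2.\<close>

definition Dset :: "real \<Rightarrow> (real \<times> real) set" where
  "Dset T = UNIV \<times> {0..T}"

definition tperiodic :: "real \<Rightarrow> (real \<times> real \<Rightarrow> real) \<Rightarrow> bool" where
  "tperiodic T w \<longleftrightarrow> (\<forall>x t. w (x, t + T) = w (x, t))"

definition px :: "(real \<times> real \<Rightarrow> real) \<Rightarrow> real \<times> real \<Rightarrow> real" where
  "px f z = frechet_derivative f (at z) (1, 0)"

definition pt :: "(real \<times> real \<Rightarrow> real) \<Rightarrow> real \<times> real \<Rightarrow> real" where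
  "pt f z = frechet_derivative f (at z) (0, 1)"

coinductive smooth2 :: "(real \<times> real \<Rightarrow> real) \<Rightarrow> bool" where
  "(\<forall>z. f differentiable (at z)) \<Longrightarrow> smooth2 (px f) \<Longrightarrow> smooth2 (pt f) \<Longrightarrow> smooth2 f"

coinductive smooth1 :: "(real \<Rightarrow> real) \<Rightarrow> bool" where
  "(\<forall>x. f differentiable (at x)) \<Longrightarrow> smooth1 (deriv f) \<Longrightarrow> smooth1 f"

definition test_fun :: "real \<Rightarrow> (real \<times> real \<Rightarrow> real) \<Rightarrow> bool" where
  "test_fun T \<psi> \<longleftrightarrow> smooth2 \<psi> \<and> tperiodic T \<psi> \<and> (\<exists>R. \<forall>x t. R < \<bar>x\<bar> \<longrightarrow> \<psi> (x, t) = 0)"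

definition test_fun_torus :: "real \<Rightarrow> (real \<Rightarrow> real) \<Rightarrow> bool" where
  "test_fun_torus T \<phi> \<longleftrightarrow> smooth1 \<phi> \<and> (\<forall>t. \<phi> (t + T) = \<phi> t)"

definition L2D :: "real \<Rightarrow> (real \<times> real \<Rightarrow> real) \<Rightarrow> bool" where
  "L2D T f \<longleftrightarrow> f \<in> borel_measurable lborel \<and> set_integrable lborel (Dset T) (\<lambda>z. (f z)\<^sup>2)"

definition Lp_torus :: "nat \<Rightarrow> real \<Rightarrow> (real \<Rightarrow> real) \<Rightarrow> bool" where
  "Lp_torus p T f \<longleftrightarrow> f \<in> borel_measurable lborel \<and> set_integrable lborel {0..T} (\<lambda>t. \<bar>f t\<bar> ^ p)"

definition weak_derivs :: "real \<Rightarrow> (real \<times> real \<Rightarrow> real) \<Rightarrow> (real \<times> real \<Rightarrow> real)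
    \<Rightarrow> (real \<times> real \<Rightarrow> real) \<Rightarrow> bool" where
  "weak_derivs T w wx wt \<longleftrightarrow>
     (\<forall>\<psi>. test_fun T \<psi> \<longrightarrow>
        (LINT z:Dset T|lborel. w z * px \<psi> z) = - (LINT z:Dset T|lborel. wx z * \<psi> z) \<and>
        (LINT z:Dset T|lborel. w z * pt \<psi> z) = - (LINT z:Dset T|lborel. wt z * \<psi> z))"

definition H1D :: "real \<Rightarrow> (real \<times> real \<Rightarrow> real) \<Rightarrow> bool" where
  "H1D T w \<longleftrightarrow> tperiodic T w \<and> L2D T w \<and>
     (\<exists>wx wt. L2D T wx \<and> L2D T wt \<and> weak_derivs T w wx wt)"

definition is_trace0 :: "real \<Rightarrow> (real \<times> real \<Rightarrow> real) \<Rightarrow> (real \<Rightarrow> real) \<Rightarrow> bool" where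
  "is_trace0 T w u0 \<longleftrightarrow> Lp_torus 2 T u0 \<and>
     ((\<lambda>\<epsilon>. (1 / (2 * \<epsilon>)) * (LINT z:{-\<epsilon>..\<epsilon>} \<times> {0..T}|lborel. (w z - u0 (snd z))\<^sup>2))
        \<longlongrightarrow> 0) (at_right 0)"

definition weak_deriv_torus :: "real \<Rightarrow> (real \<Rightarrow> real) \<Rightarrow> (real \<Rightarrow> real) \<Rightarrow> bool" where
  "weak_deriv_torus T u v \<longleftrightarrow>
     (\<forall>\<phi>. test_fun_torus T \<phi> \<longrightarrow>
        (LINT t:{0..T}|lborel. u t * deriv \<phi> t) = - (LINT t:{0..T}|lborel. v t * \<phi> t))"

definition weak_solution :: "real \<Rightarrow> (real \<Rightarrow> real) \<Rightarrow> real \<Rightarrow> (real \<times> real \<Rightarrow> real) \<Rightarrow> bool" where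
  "weak_solution T g \<gamma> w \<longleftrightarrow> H1D T w \<and>
     (\<exists>wx wt u0 v. L2D T wx \<and> L2D T wt \<and> weak_derivs T w wx wt \<and>
        is_trace0 T w u0 \<and> weak_deriv_torus T u0 v \<and> Lp_torus 3 T v \<and>
        (\<forall>\<psi>. test_fun T \<psi> \<longrightarrow>
          (LINT z:Dset T|lborel. - g (fst z) * wt z * pt \<psi> z + wx z * px \<psi> z)
          - \<gamma> * (LINT t:{0..T}|lborel. (v t) ^ 3 * pt \<psi> (0, t)) = 0))"

definition ae_eqD :: "real \<Rightarrow> (real \<times> real \<Rightarrow> real) \<Rightarrow> (real \<times> real \<Rightarrow> real) \<Rightarrow> bool" where
  "ae_eqD T u w \<longleftrightarrow> (AE z in lborel. z \<in> Dset T \<longrightarrow> u z = w z)"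

end

theory Submission
  imports Defs "HOL-Probability.Sinc_Integral"
begin

text \<open>Look for even waves \<open>w(x,t) = \<alpha>(|x|) (U(t - \<xi>(|x|)) + \<sigma> U(t + \<xi>(|x|)))\<close>, where \<open>\<xi>\<close> is the travel
  time with \<open>\<xi>' = g\<^bsup>1/2\<^esup>\<close>, \<open>\<alpha>\<close> is constant in each layer, and \<open>\<sigma> = 1\<close> if \<open>b < a\<close>, \<open>\<sigma> = -1\<close> otherwise.
  The oddness conditions say that every layer takes an odd multiple of a time \<open>Q = T/(4m)\<close> to cross.
  If \<open>U\<close> changes sign under the shift by \<open>2Q\<close>, then at each interface either \<open>w\<close> or \<open>w\<^sub>x\<close> vanishes
  identically in time, and where \<open>w\<close> vanishes \<open>\<alpha>\<close> may jump; the choice of \<open>\<sigma>\<close> makes it decay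
  geometrically. The condition at \<open>x = 0\<close> becomes the delay equation \<open>(v\<^sup>3)' = \<kappa> v(t + 2\<tau>)\<close> for
  \<open>v = w\<^sub>t(0,\<cdot>)\<close>, where \<open>\<tau>\<close> is the travel time across half the inner layer. It is solved by rescaling one
  explicit oscillation \<open>\<phi>\<close> with \<open>(\<phi>\<^sup>3)' = \<phi>(t + Q)\<close> and \<open>\<phi>(t + 2Q) = -\<phi>(t)\<close>. Infinitely many \<open>m\<close> are
  admissible, and they give different amplitudes.\<close>

section \<open>Integration over the cylinder\<close>

text \<open>The sign of \<open>\<gamma>\<close> is arbitrary, so \<open>\<kappa>\<close> may be
  negative. Antiperiodicity absorbs this: \<open>v (t + 3 * Q) = - v (t + Q)\<close>, so an inner
  crossing time congruent to \<open>3 * Q\<close> instead of \<open>Q\<close> modulo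
  \<open>4 * Q\<close> reverses the sign of the delay term. Hence the residue of the crossing time
  modulo 4 matters, not only its oddness, and \<open>m\<close> runs through multiples of a
  progression with step 4.

  If travel time is counted from the right end \<open>x = A\<close> of the central layer, twice the
  phase at an interface is a multiple of \<open>4 * Q\<close> at right ends of inner layers and
  differs from one by \<open>2 * Q\<close> at left ends. So the two travelling parts are equal at
  one kind of interface and opposite at the other, and they cancel in \<open>w\<close> at one and in
  the flux at the other.

  In time only the antiderivative \<open>u\<close> and the cube of \<open>v\<close> are
  differentiated, and \<open>u\<close> is itself a multiple of a shifted cube of
  \<open>v\<close>.\<close>

lemma integrable_inverse_one_plus_square:
  "integrable lborel (\<lambda>x::real. inverse (1 + x\<^sup>2))"
  using integrable_inverse_1_plus_square by (simp add: set_integrable_def)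

text \<open>Every integral over the cylinder is dominated by a multiple of 1/(1 + x^2); the
  quadratic Taylor bound of exp brings exponential decay into this form.\<close>

lemma exp_minus_le_inverse_one_plus_square:
  fixes \<rho> :: real
  assumes "\<rho> > 0"
  obtains K where "K > 0" "\<And>x. exp (- \<rho> * \<bar>x\<bar>) \<le> K * inverse (1 + x\<^sup>2)"
proof -
  \<comment> \<open>This value makes K (1 + (\<rho> x)^2 / 2) equal to 1 + x^2 plus nonnegative
    terms.\<close>
  define K where "K = 1 + 2 / \<rho>\<^sup>2"
  have Kpos: "K > 0" using assms by (simp add: K_def add_pos_nonneg)
  have "exp (- \<rho> * \<bar>x\<bar>) \<le> K * inverse (1 + x\<^sup>2)" for x
  proof -
    have "1 + (\<rho> * \<bar>x\<bar>)\<^sup>2 / 2 \<le> exp (\<rho> * \<bar>x\<bar>)"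
      using exp_lower_Taylor_quadratic[of "\<rho> * \<bar>x\<bar>"] assms
      by (smt (verit) abs_ge_zero mult_nonneg_nonneg)
    moreover have "1 + x\<^sup>2 \<le> K * (1 + (\<rho> * \<bar>x\<bar>)\<^sup>2 / 2)"
    proof -
      have "K * (1 + (\<rho> * \<bar>x\<bar>)\<^sup>2 / 2) = 1 + x\<^sup>2 + \<rho>\<^sup>2 * x\<^sup>2 / 2 + 2 / \<rho>\<^sup>2"
        using assms by (simp add: K_def power_mult_distrib field_simps power2_eq_square)
      then show ?thesis by simp
    qed
    ultimately have "1 + x\<^sup>2 \<le> K * exp (\<rho> * \<bar>x\<bar>)"
      using Kpos by (meson mult_left_mono less_imp_le order_trans)
    then have "(1 + x\<^sup>2) * exp (- \<rho> * \<bar>x\<bar>) \<le> K * exp (\<rho> * \<bar>x\<bar>) * exp (- \<rho> * \<bar>x\<bar>)"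
      by (intro mult_right_mono) auto
    also have "\<dots> = K" by (simp add: exp_minus)
    finally show ?thesis
      by (smt (verit) divide_inverse mult.commute pos_le_divide_eq zero_le_power2)
  qed
  with Kpos show ?thesis using that by blast
qed

lemma measurable_section:
  fixes f :: "real \<times> real \<Rightarrow> real"
  assumes "f \<in> borel_measurable borel"
  shows "(\<lambda>t. f (x, t)) \<in> borel_measurable borel" "(\<lambda>x. f (x, t)) \<in> borel_measurable borel"
proof -
  have [measurable]: "f \<in> borel_measurable (borel \<Otimes>\<^sub>M borel)"
    using assms by (simp add: borel_prod)
  show "(\<lambda>t. f (x, t)) \<in> borel_measurable borel" "(\<lambda>x. f (x, t)) \<in> borel_measurable borel"
    by measurable
qed

text \<open>A single majorant justifies Fubini in both orders. Integrating first in x serves the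
  x-derivative of the wave; integrating first in t serves its t-derivative and the weak
  equation.\<close>

lemma
  fixes f :: "real \<times> real \<Rightarrow> real"
  assumes f: "f \<in> borel_measurable borel"
    and bound: "\<And>x t. t \<in> {0..T} \<Longrightarrow> \<bar>f (x, t)\<bar> \<le> C * inverse (1 + x\<^sup>2)"
  shows set_integrable_Dset: "set_integrable lborel (Dset T) f"
    and integral_Dset_fst:
      "(LINT z:Dset T|lborel. f z) = (LINT x|lborel. (LINT t:{0..T}|lborel. f (x, t)))"
    and integrable_Dset_fst: "integrable lborel (\<lambda>x. LINT t:{0..T}|lborel. f (x, t))"
    and integral_Dset_snd:
      "(LINT z:Dset T|lborel. f z) = (LINT t:{0..T}|lborel. (LINT x|lborel. f (x, t)))"
    and integrable_Dset_section: "\<And>t. t \<in> {0..T} \<Longrightarrow> integrable lborel (\<lambda>x. f (x, t))"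
proof -
  define h :: "real \<times> real \<Rightarrow> real" where "h z = indicator (Dset T) z *\<^sub>R f z" for z
  define H :: "real \<times> real \<Rightarrow> real" where
    "H z = C * inverse (1 + (fst z)\<^sup>2) * indicator {0..T} (snd z)" for z
  have [measurable]: "f \<in> borel_measurable (borel \<Otimes>\<^sub>M borel)"
    using f by (simp add: borel_prod)
  have hxt: "h (x, t) = indicator {0..T} t *\<^sub>R f (x, t)" for x t
    by (simp add: h_def Dset_def indicator_def)
  have mh: "h \<in> borel_measurable (lborel \<Otimes>\<^sub>M lborel)"
  proof -
    have "(\<lambda>z. indicator {0..T} (snd z) *\<^sub>R f z) \<in> borel_measurable (lborel \<Otimes>\<^sub>M lborel)"
      by measurable
    moreover have "h = (\<lambda>z. indicator {0..T} (snd z) *\<^sub>R f z)"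
      using hxt by auto
    ultimately show ?thesis by simp
  qed
  have "integrable (lborel \<Otimes>\<^sub>M lborel) H"
  proof (rule lborel_pair.Fubini_integrable)
    show "H \<in> borel_measurable (lborel \<Otimes>\<^sub>M lborel)"
      unfolding H_def by measurable
    \<comment> \<open>Nothing forces \<open>C \<ge> 0\<close> when \<open>{0..T}\<close> is empty,
      hence the absolute value.\<close>
    have "(\<lambda>x. \<integral>y. norm (H (x, y)) \<partial>lborel)
       = (\<lambda>x. (\<bar>C\<bar> * (LINT t|lborel. indicator {0..T} t)) * inverse (1 + x\<^sup>2))"
    proof
      fix x
      have "(\<lambda>y. norm (H (x, y))) = (\<lambda>y. (\<bar>C\<bar> * inverse (1 + x\<^sup>2)) * indicator {0..T} y)"
        by (auto simp: H_def abs_mult indicator_def)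
      then show "(\<integral>y. norm (H (x, y)) \<partial>lborel) = (\<bar>C\<bar> * (LINT t|lborel. indicator {0..T} t)) * inverse (1 + x\<^sup>2)"
        by simp
    qed
    then show "integrable lborel (\<lambda>x. \<integral>y. norm (H (x, y)) \<partial>lborel)"
      using integrable_inverse_one_plus_square by simp
    show "AE x in lborel. integrable lborel (\<lambda>y. H (x, y))"
      unfolding H_def by (auto simp: emeasure_lborel_Icc_eq)
  qed
  then have ih: "integrable (lborel \<Otimes>\<^sub>M lborel) h"
  proof (rule Bochner_Integration.integrable_bound)
    show "h \<in> borel_measurable (lborel \<Otimes>\<^sub>M lborel)" by (rule mh)
    show "AE z in lborel \<Otimes>\<^sub>M lborel. norm (h z) \<le> norm (H z)"
    proof (rule AE_I2)
      fix z :: "real \<times> real"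
      obtain x t where z: "z = (x, t)" by (cases z)
      show "norm (h z) \<le> norm (H z)"
        using bound[of t x] mult_right_mono[OF abs_ge_self[of C], of "inverse (1 + x\<^sup>2)"]
        by (auto simp: z hxt H_def indicator_def abs_mult)
    qed
  qed
  show "set_integrable lborel (Dset T) f"
    using ih unfolding set_integrable_def h_def lborel_prod .
  have eq: "(LINT z:Dset T|lborel. f z) = integral\<^sup>L (lborel \<Otimes>\<^sub>M lborel) h"
    unfolding set_lebesgue_integral_def h_def lborel_prod ..
  show "(LINT z:Dset T|lborel. f z) = (LINT x|lborel. (LINT t:{0..T}|lborel. f (x, t)))"
    unfolding eq using lborel_pair.integral_fst'[OF ih]
    by (simp add: hxt set_lebesgue_integral_def)
  show "integrable lborel (\<lambda>x. LINT t:{0..T}|lborel. f (x, t))"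
    unfolding set_lebesgue_integral_def using lborel_pair.integrable_fst'[OF ih]
    by (simp add: hxt)
  have "(LINT z:Dset T|lborel. f z) = (LINT t|lborel. (LINT x|lborel. h (x, t)))"
    unfolding eq using lborel_pair.integral_snd[of "\<lambda>x t. h (x, t)"] ih by simp
  also have "\<dots> = (LINT t:{0..T}|lborel. (LINT x|lborel. f (x, t)))"
    unfolding set_lebesgue_integral_def by (simp add: hxt)
  finally show "(LINT z:Dset T|lborel. f z) = (LINT t:{0..T}|lborel. (LINT x|lborel. f (x, t)))" .
  show "integrable lborel (\<lambda>x. f (x, t))" if t: "t \<in> {0..T}" for t
  proof (rule Bochner_Integration.integrable_bound)
    show "integrable lborel (\<lambda>x. C * inverse (1 + x\<^sup>2))"
      using integrable_inverse_one_plus_square by simp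
    show "(\<lambda>x. f (x, t)) \<in> borel_measurable lborel"
      using measurable_section(2)[OF f] by simp
    show "AE x in lborel. norm (f (x, t)) \<le> norm (C * inverse (1 + x\<^sup>2))"
      using bound[OF t] by (intro AE_I2) (simp, smt (verit))
  qed
qed

section \<open>One-dimensional calculus: exceptional points, primitives, periodic shifts\<close>

lemma set_lborel_integral_continuous:
  fixes f :: "real \<Rightarrow> real"
  assumes "continuous_on {a..b} f"
  shows "(LINT t:{a..b}|lborel. f t) = integral {a..b} f"
  using borel_integrable_compact[of "{a..b}" f] assms
  by (intro set_borel_integral_eq_integral) (simp add: set_integrable_def)

text \<open>The primitives on the two half-lines may differ, and their mismatch at 0 is all that
  survives. It is 0 for the weak derivative of a continuous wave and yields the delta term for the
  flux. At points of \<open>S\<close> only continuity is asked for.\<close>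

lemma integral_two_sided_derivative:
  fixes K F G :: "real \<Rightarrow> real"
  assumes K: "integrable lborel K" and S: "\<And>r. finite (S \<inter> {-r..r})"
    and contF: "continuous_on {0..} F" and contG: "continuous_on {..0} G"
    and dF: "\<And>x. x > 0 \<Longrightarrow> x \<notin> S \<Longrightarrow> (F has_real_derivative K x) (at x)"
    and dG: "\<And>x. x < 0 \<Longrightarrow> x \<notin> S \<Longrightarrow> (G has_real_derivative K x) (at x)"
    and F0: "\<And>x. x > R \<Longrightarrow> F x = 0" and G0: "\<And>x. x < - R \<Longrightarrow> G x = 0"
    and K0: "\<And>x. \<bar>x\<bar> > R \<Longrightarrow> K x = 0"
  shows "integral\<^sup>L lborel K = G 0 - F 0"
proof -
  define r where "r = \<bar>R\<bar> + 1"
  have r: "r > 0" "r > R" by (auto simp: r_def)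
  have "(K has_integral (F r - F 0)) {0..r}"
  proof (rule fundamental_theorem_of_calculus_strong[of "insert 0 (S \<inter> {-r..r})"])
    show "continuous_on {0..r} F" by (rule continuous_on_subset[OF contF]) auto
    show "(F has_vector_derivative K x) (at x)" if "x \<in> {0..r} - insert 0 (S \<inter> {-r..r})" for x
      using dF[of x] that by (auto simp: has_real_derivative_iff_has_vector_derivative)
  qed (use S r in auto)
  moreover have "(K has_integral (G 0 - G (-r))) {-r..0}"
  proof (rule fundamental_theorem_of_calculus_strong[of "insert 0 (S \<inter> {-r..r})"])
    show "continuous_on {-r..0} G" by (rule continuous_on_subset[OF contG]) auto
    show "(G has_vector_derivative K x) (at x)" if "x \<in> {-r..0} - insert 0 (S \<inter> {-r..r})" for x
      using dG[of x] that by (auto simp: has_real_derivative_iff_has_vector_derivative)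
  qed (use S r in auto)
  ultimately have "(K has_integral ((G 0 - G (-r)) + (F r - F 0))) {-r..r}"
    using r by (intro has_integral_combine[of "-r" 0 r]) auto
  then have "(K has_integral (G 0 - F 0)) {-r..r}"
    using F0[of r] G0[of "-r"] r by simp
  then have "(K has_integral (G 0 - F 0)) UNIV"
    by (rule has_integral_on_superset) (use K0 r in \<open>auto simp: abs_if\<close>)
  with has_integral_integral_lborel[OF K] show ?thesis
    by (rule has_integral_unique)
qed

lemma continuous_antiderivative_exists:
  fixes f :: "real \<Rightarrow> real"
  assumes "continuous_on UNIV f"
  obtains F where "\<And>x. (F has_real_derivative f x) (at x)"
proof -
  have "\<exists>F. \<forall>x :: real. -\<infinity> < ereal x \<longrightarrow> ereal x < \<infinity> \<longrightarrow> (F has_vector_derivative f x) (at x)"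
    using assms by (intro einterval_antiderivative) (auto simp: continuous_on_eq_continuous_at)
  then show ?thesis
    using that by (auto simp: has_real_derivative_iff_has_vector_derivative)
qed

lemma integral_derivative:
  fixes F f :: "real \<Rightarrow> real"
  assumes "\<And>x. (F has_real_derivative f x) (at x)" "a \<le> b"
  shows "integral {a..b} f = F b - F a"
  using assms
  by (intro integral_unique fundamental_theorem_of_calculus)
     (auto simp: has_real_derivative_iff_has_vector_derivative[symmetric] has_field_derivative_at_within)

lemma integral_periodic_shift:
  fixes f :: "real \<Rightarrow> real"
  assumes cont: "continuous_on UNIV f" and per: "\<And>t. f (t + T) = f t" and T: "T \<ge> 0"
  shows "integral {0..T} (\<lambda>t. f (t + c)) = integral {0..T} f"
proof -
  obtain F where F: "\<And>x. (F has_real_derivative f x) (at x)"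
    using continuous_antiderivative_exists[OF cont] by blast
  have Fs: "((\<lambda>x. F (x + d)) has_real_derivative f (x + d)) (at x)" for x d
    using DERIV_shift[of F "f (x + d)" x d] F by simp
  have "((\<lambda>x. F (x + T) - F x) has_real_derivative 0) (at x)" for x
    using DERIV_diff[OF Fs F, of T x] per by simp
  then have "F (c + T) - F c = F (0 + T) - F 0"
    using DERIV_isconst_all[of "\<lambda>x. F (x + T) - F x" c 0] by blast
  then show ?thesis
    using integral_derivative[OF Fs T, of c] integral_derivative[OF F T]
    by (simp add: add.commute)
qed

text \<open>The set of disagreement inside the open strip is open and null, hence empty. This allows
  solutions to be told apart by their values on the line x = 0, where they are known
  exactly.\<close>

lemma continuous_AE_eq_Dset:
  assumes cont: "continuous_on UNIV f" "continuous_on UNIV h" and ae: "ae_eqD T f h"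
    and t: "0 < t" "t < T"
  shows "f (x, t) = h (x, t)"
proof (rule ccontr)
  assume neq: "f (x, t) \<noteq> h (x, t)"
  define A where "A = {z. f z \<noteq> h z} \<inter> (UNIV \<times> {0<..<T})"
  have "open A" unfolding A_def
    using cont by (intro open_Int open_Times open_Collect_neq) auto
  moreover have "A \<noteq> {}" using neq t by (auto simp: A_def)
  ultimately obtain c d where cd: "box c d \<noteq> {}" "box c d \<subseteq> A"
    by (metis ex_in_conv open_contains_box)
  moreover have "negligible A"
  proof -
    have "AE z in lborel. z \<notin> A"
      using ae unfolding ae_eqD_def by eventually_elim (auto simp: A_def Dset_def)
    then have "A \<in> null_sets lborel"
      using \<open>open A\<close> by (subst (asm) AE_iff_null_sets[symmetric]) auto
    then show ?thesis
      by (simp add: negligible_iff_null_sets null_sets_completionI)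
  qed
  ultimately show False
    using negligible_subset negligible_interval(2) by metis
qed

section \<open>Test functions\<close>

lemma smooth2_has_derivative:
  assumes "smooth2 f"
  shows "(f has_derivative (\<lambda>h. fst h * px f z + snd h * pt f z)) (at z)"
proof -
  have "f differentiable (at z)" using assms by (auto elim: smooth2.cases)
  then have D: "(f has_derivative frechet_derivative f (at z)) (at z)"
    by (rule frechet_derivative_works[THEN iffD1])
  then have lin: "linear (frechet_derivative f (at z))"
    by (rule has_derivative_linear)
  have "frechet_derivative f (at z) h = fst h * px f z + snd h * pt f z" for h
  proof -
    have "h = fst h *\<^sub>R (1, 0) + snd h *\<^sub>R (0, 1)" by (cases h) simp
    then have "frechet_derivative f (at z) h
        = frechet_derivative f (at z) (fst h *\<^sub>R (1, 0) + snd h *\<^sub>R (0, 1))" by simp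
    also have "\<dots> = fst h * px f z + snd h * pt f z"
      by (simp only: linear_add[OF lin] linear_scale[OF lin] px_def pt_def real_scaleR_def)
    finally show ?thesis .
  qed
  then have "frechet_derivative f (at z) = (\<lambda>h. fst h * px f z + snd h * pt f z)"
    by (rule ext)
  then show ?thesis using D by simp
qed

lemma smooth2_partials: "smooth2 f \<Longrightarrow> smooth2 (px f)" "smooth2 f \<Longrightarrow> smooth2 (pt f)"
  by (auto elim: smooth2.cases)

lemma smooth2_continuous_on: "smooth2 f \<Longrightarrow> continuous_on A f"
  by (meson has_derivative_continuous_on has_derivative_at_withinI smooth2_has_derivative)

lemma smooth2_chain:
  assumes "smooth2 f" "(a has_real_derivative a') (at x)" "(b has_real_derivative b') (at x)"
  shows "((\<lambda>x. f (a x, b x)) has_real_derivative a' * px f (a x, b x) + b' * pt f (a x, b x)) (at x)"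
proof -
  have "((\<lambda>x. (a x, b x)) has_derivative (\<lambda>h. (a' * h, b' * h))) (at x)"
    using assms(2,3) unfolding has_field_derivative_def
    by (intro has_derivative_Pair) auto
  from has_derivative_compose[OF this smooth2_has_derivative[OF assms(1)]]
  have "((\<lambda>x. f (a x, b x)) has_derivative
     (\<lambda>h. a' * h * px f (a x, b x) + b' * h * pt f (a x, b x))) (at x)"
    by simp
  then show ?thesis
    unfolding has_field_derivative_def by (rule has_derivative_eq_rhs) (auto simp: algebra_simps)
qed

lemma smooth2_px: "smooth2 f \<Longrightarrow> ((\<lambda>x. f (x, t)) has_real_derivative px f (x, t)) (at x)"
  using smooth2_chain[of f "\<lambda>x. x" 1 x "\<lambda>_. t" 0] by simp

lemma smooth2_pt: "smooth2 f \<Longrightarrow> ((\<lambda>t. f (x, t)) has_real_derivative pt f (x, t)) (at t)"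
  using smooth2_chain[of f "\<lambda>_. x" 0 t "\<lambda>t. t" 1] by simp

lemma test_fun_smooth2: "test_fun T \<psi> \<Longrightarrow> smooth2 \<psi>"
  and test_fun_periodic: "test_fun T \<psi> \<Longrightarrow> \<psi> (x, t + T) = \<psi> (x, t)"
  by (auto simp: test_fun_def tperiodic_def)

text \<open>Closure under derivatives makes every bound for test functions available for
  \<open>px \<psi>\<close> and \<open>pt \<psi>\<close>. Periodicity and support pass to the
  partials by uniqueness of derivatives.\<close>

lemma test_fun_partials:
  assumes "test_fun T \<psi>"
  shows "test_fun T (px \<psi>)" "test_fun T (pt \<psi>)"
proof -
  note sm = test_fun_smooth2[OF assms] and per = test_fun_periodic[OF assms]
  obtain R where R: "\<And>x t. R < \<bar>x\<bar> \<Longrightarrow> \<psi> (x, t) = 0"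
    using assms unfolding test_fun_def by blast
  have "px \<psi> (x, t + T) = px \<psi> (x, t)" for x t
  proof (rule DERIV_unique)
    show "((\<lambda>x. \<psi> (x, t)) has_real_derivative px \<psi> (x, t)) (at x)"
      using smooth2_px[OF sm] .
    show "((\<lambda>x. \<psi> (x, t)) has_real_derivative px \<psi> (x, t + T)) (at x)"
      using smooth2_px[OF sm, of "t + T" x] by (simp add: per)
  qed
  moreover have "pt \<psi> (x, t + T) = pt \<psi> (x, t)" for x t
  proof (rule DERIV_unique)
    show "((\<lambda>t. \<psi> (x, t)) has_real_derivative pt \<psi> (x, t)) (at t)"
      using smooth2_pt[OF sm] .
    show "((\<lambda>t. \<psi> (x, t)) has_real_derivative pt \<psi> (x, t + T)) (at t)"
      using DERIV_shift[of "\<lambda>t. \<psi> (x, t)" "pt \<psi> (x, t + T)" t T] smooth2_pt[OF sm, of x "t + T"]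
      by (simp add: per)
  qed
  moreover have px0: "px \<psi> (x, t) = 0" if x: "R < \<bar>x\<bar>" for x t
  proof (rule DERIV_unique)
    show "((\<lambda>x. \<psi> (x, t)) has_real_derivative px \<psi> (x, t)) (at x)"
      by (rule smooth2_px[OF sm])
    have "open {x::real. R < \<bar>x\<bar>}" by (intro open_Collect_less continuous_intros)
    then show "((\<lambda>x. \<psi> (x, t)) has_real_derivative 0) (at x)"
      by (rule has_field_derivative_transform_within_open[of "\<lambda>_. 0", rotated]) (use x R in auto)
  qed
  moreover have pt0: "pt \<psi> (x, t) = 0" if x: "R < \<bar>x\<bar>" for x t
  proof (rule DERIV_unique)
    show "((\<lambda>t. \<psi> (x, t)) has_real_derivative pt \<psi> (x, t)) (at t)"
      using smooth2_pt[OF sm] .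
    show "((\<lambda>t. \<psi> (x, t)) has_real_derivative 0) (at t)"
      by (simp add: R[OF x])
  qed
  ultimately show "test_fun T (px \<psi>)" "test_fun T (pt \<psi>)"
    unfolding test_fun_def tperiodic_def
    by (intro conjI allI exI[of _ R] impI smooth2_partials[OF sm]; simp)+
qed

lemma test_fun_bound:
  assumes "test_fun T \<psi>"
  obtains C where "C \<ge> 0" "\<And>x t. t \<in> {0..T} \<Longrightarrow> \<bar>\<psi> (x, t)\<bar> \<le> C * inverse (1 + x\<^sup>2)"
proof -
  obtain R where R: "\<And>x t. R < \<bar>x\<bar> \<Longrightarrow> \<psi> (x, t) = 0"
    using assms by (auto simp: test_fun_def)
  have "compact ((\<lambda>z. \<psi> z * (1 + (fst z)\<^sup>2)) ` ({-R..R} \<times> {0..T}))"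
    by (intro compact_continuous_image compact_Times continuous_intros
        smooth2_continuous_on[OF test_fun_smooth2[OF assms]]) auto
  then have "bounded ((\<lambda>z. \<psi> z * (1 + (fst z)\<^sup>2)) ` ({-R..R} \<times> {0..T}))"
    by (rule compact_imp_bounded)
  then obtain B where "\<forall>y\<in>(\<lambda>z. \<psi> z * (1 + (fst z)\<^sup>2)) ` ({-R..R} \<times> {0..T}). norm y \<le> B"
    unfolding bounded_iff by blast
  then have B: "\<bar>\<psi> z * (1 + (fst z)\<^sup>2)\<bar> \<le> B" if "z \<in> {-R..R} \<times> {0..T}" for z
    using that unfolding real_norm_def by blast
  show ?thesis
  \<comment> \<open>\<open>B\<close> may be negative when the compact set is empty, but a
    nonnegative constant is promised.\<close>
  proof (rule that[of "\<bar>B\<bar>"])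
    fix x t assume t: "t \<in> {0..T}"
    show "\<bar>\<psi> (x, t)\<bar> \<le> \<bar>B\<bar> * inverse (1 + x\<^sup>2)"
    proof (cases "R < \<bar>x\<bar>")
      case False
      then have "\<bar>\<psi> (x, t)\<bar> * (1 + x\<^sup>2) \<le> \<bar>B\<bar>"
        using B[of "(x, t)"] t by (auto simp: abs_mult abs_if split: if_splits)
      then show ?thesis
        by (simp add: divide_inverse[symmetric] pos_le_divide_eq add_pos_nonneg)
    qed (simp add: R)
  qed simp
qed

lemma test_fun_measurable: "test_fun T \<psi> \<Longrightarrow> \<psi> \<in> borel_measurable borel"
  by (intro borel_measurable_continuous_onI smooth2_continuous_on test_fun_smooth2)

lemma mult_test_fun_bound:
  fixes f \<psi> :: "real \<times> real \<Rightarrow> real"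
  assumes f: "f \<in> borel_measurable borel" and bd: "\<And>z. \<bar>f z\<bar> \<le> M" and \<psi>: "test_fun T \<psi>"
  obtains C where "(\<lambda>z. f z * \<psi> z) \<in> borel_measurable borel"
    "\<And>x t. t \<in> {0..T} \<Longrightarrow> \<bar>f (x, t) * \<psi> (x, t)\<bar> \<le> C * inverse (1 + x\<^sup>2)"
proof -
  obtain C where C: "C \<ge> 0" "\<And>x t. t \<in> {0..T} \<Longrightarrow> \<bar>\<psi> (x, t)\<bar> \<le> C * inverse (1 + x\<^sup>2)"
    using test_fun_bound[OF \<psi>] by blast
  have M: "M \<ge> 0" using bd[of undefined] by linarith
  show ?thesis
  proof (rule that[of "M * C"])
    show "(\<lambda>z. f z * \<psi> z) \<in> borel_measurable borel"
      using f test_fun_measurable[OF \<psi>] by simp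
    show "\<bar>f (x, t) * \<psi> (x, t)\<bar> \<le> M * C * inverse (1 + x\<^sup>2)" if "t \<in> {0..T}" for x t
      using mult_mono[OF bd[of "(x, t)"] C(2)[OF that] M] by (simp add: abs_mult mult.assoc)
  qed
qed

text \<open>The profile \<open>V\<close> need not be differentiable: the periodic shift moves the \<open>x\<close>-dependence onto
  the test function.\<close>

lemma travelling_wave_derivative:
  assumes V: "continuous_on UNIV V" and Vper: "\<And>t. V (t + T) = V t" and T: "T \<ge> 0"
    and \<psi>: "test_fun T \<psi>"
  shows "((\<lambda>x. integral {0..T} (\<lambda>t. V (t - (c + k * (x - x0))) * \<psi> (x, t)))
    has_real_derivative
      integral {0..T} (\<lambda>t. V (t - c) * (px \<psi> (x0, t) + k * pt \<psi> (x0, t)))) (at x0)"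
proof -
  note sm = test_fun_smooth2[OF \<psi>] and tp = test_fun_partials[OF \<psi>]
  note smp = test_fun_smooth2[OF tp(1)] test_fun_smooth2[OF tp(2)]
  note cts = smooth2_continuous_on[OF sm] smooth2_continuous_on[OF smp(1)] smooth2_continuous_on[OF smp(2)]
  have shift: "integral {0..T} (\<lambda>t. V (t - d) * f t) = integral {0..T} (\<lambda>t. V t * f (t + d))"
    if "continuous_on UNIV f" "\<And>t. f (t + T) = f t" for f d
  proof -
    have "integral {0..T} (\<lambda>t. V t * f (t + d)) = integral {0..T} (\<lambda>t. (\<lambda>r. V (r - d) * f r) (t + d))"
      by simp
    also have "\<dots> = integral {0..T} (\<lambda>t. V (t - d) * f t)"
    proof (rule integral_periodic_shift[OF _ _ T])
      show "continuous_on UNIV (\<lambda>r. V (r - d) * f r)"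
        by (intro continuous_intros continuous_on_compose2[OF V] that(1)) auto
      show "V (t + T - d) * f (t + T) = V (t - d) * f t" for t
        using Vper[of "t - d"] that(2)[of t] by (simp add: algebra_simps)
    qed
    finally show ?thesis ..
  qed
  \<comment> \<open>After the shift \<open>V\<close> no longer depends on x, so the Leibniz rule
    differentiates only \<open>\<psi>\<close>.\<close>
  have eq1: "integral {0..T} (\<lambda>t. V (t - (c + k * (x - x0))) * \<psi> (x, t))
      = integral {0..T} (\<lambda>t. V t * \<psi> (x, t + (c + k * (x - x0))))" for x
    by (rule shift) (auto intro!: continuous_on_compose2[OF cts(1)] continuous_intros
        simp: test_fun_periodic[OF \<psi>])
  have eq2: "integral {0..T} (\<lambda>t. V (t - c) * (px \<psi> (x0, t) + k * pt \<psi> (x0, t)))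
      = integral {0..T} (\<lambda>t. V t * (px \<psi> (x0, t + c) + k * pt \<psi> (x0, t + c)))"
    by (rule shift) (auto intro!: continuous_on_compose2[OF cts(2)] continuous_on_compose2[OF cts(3)]
        continuous_intros simp: test_fun_periodic[OF tp(1)] test_fun_periodic[OF tp(2)])
  have "((\<lambda>x. integral (cbox 0 T) (\<lambda>t. V t * \<psi> (x, t + (c + k * (x - x0)))))
    has_real_derivative integral (cbox 0 T)
      (\<lambda>t. V t * (px \<psi> (x0, t + (c + k * (x0 - x0))) + k * pt \<psi> (x0, t + (c + k * (x0 - x0))))))
      (at x0 within UNIV)"
  proof (rule leibniz_rule_field_derivative[where fx = "\<lambda>x t.
        V t * (px \<psi> (x, t + (c + k * (x - x0))) + k * pt \<psi> (x, t + (c + k * (x - x0))))"])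
    fix x t
    have "((\<lambda>x. t + (c + k * (x - x0))) has_real_derivative k) (at x)"
      by (auto intro!: derivative_eq_intros)
    from smooth2_chain[OF sm DERIV_ident this]
    show "((\<lambda>x. V t * \<psi> (x, t + (c + k * (x - x0)))) has_real_derivative
       V t * (px \<psi> (x, t + (c + k * (x - x0))) + k * pt \<psi> (x, t + (c + k * (x - x0))))) (at x within UNIV)"
      by (intro DERIV_cmult) simp
  next
    show "(\<lambda>t. V t * \<psi> (x, t + (c + k * (x - x0)))) integrable_on cbox 0 T" for x
      by (intro integrable_continuous continuous_intros continuous_on_compose2[OF cts(1)]
          continuous_on_subset[OF V]) auto
    show "continuous_on (UNIV \<times> cbox 0 T) (\<lambda>(x, t).
        V t * (px \<psi> (x, t + (c + k * (x - x0))) + k * pt \<psi> (x, t + (c + k * (x - x0)))))"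
      unfolding split_beta
      by (intro continuous_intros continuous_on_compose2[OF cts(2)] continuous_on_compose2[OF cts(3)]
          continuous_on_compose2[OF V]) auto
  qed auto
  then show ?thesis
    by (simp add: eq1 eq2)
qed

section \<open>The delay oscillator\<close>

text \<open>Subtracting a primitive of \<open>h\<close> leaves a continuous function with derivative
  0 off \<open>S\<close>, hence a constant. The oscillator needs this because the chain rule through
  \<open>\<theta>\<close> fails wherever the sine or cosine of \<open>\<theta>\<close>
  vanishes.\<close>

lemma has_derivative_off_locally_finite:
  fixes f h :: "real \<Rightarrow> real"
  assumes f: "continuous_on UNIV f" and h: "continuous_on UNIV h"
    and S: "\<And>r. finite (S \<inter> {-r..r})"
    and d: "\<And>x. x \<notin> S \<Longrightarrow> (f has_real_derivative h x) (at x)"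
  shows "(f has_real_derivative h x) (at x)"
proof -
  obtain H where H: "\<And>x. (H has_real_derivative h x) (at x)"
    using continuous_antiderivative_exists[OF h] by blast
  define D where "D x = f x - H x" for x
  have contD: "continuous_on A D" for A
    unfolding D_def by (intro continuous_intros continuous_on_subset[OF f] DERIV_continuous_on[of A H h])
      (auto intro: has_field_derivative_at_within H)
  have D_le: "D a = D b" if "a \<le> b" for a b
  proof -
    define r where "r = \<bar>a\<bar> + \<bar>b\<bar>"
    have "((\<lambda>_. 0) has_integral (D b - D a)) {a..b}"
    proof (rule fundamental_theorem_of_calculus_strong[of "S \<inter> {-r..r}"])
      fix x assume "x \<in> {a..b} - S \<inter> {-r..r}"
      then have "x \<notin> S" by (auto simp: r_def)
      from DERIV_diff[OF d[OF this] H]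
      show "(D has_vector_derivative 0) (at x)"
        by (simp add: D_def[abs_def] has_real_derivative_iff_has_vector_derivative)
    qed (use S that contD in auto)
    then show ?thesis using has_integral_unique has_integral_0 by force
  qed
  have "f = (\<lambda>x. H x + D 0)"
  proof
    fix x show "f x = H x + D 0"
      using D_le[of x 0] D_le[of 0 x] by (cases "x \<le> 0") (auto simp: D_def)
  qed
  then show ?thesis using DERIV_add[OF H[of x] DERIV_const[of "D 0"]] by simp
qed

text \<open>A monotone function whose range is the whole line cannot jump.\<close>

lemma continuous_inverse_of_increasing_bijection:
  fixes F :: "real \<Rightarrow> real"
  assumes "strict_mono F" "surj F"
  shows "continuous_on UNIV (inv F)"
proof -
  have "mono (inv F)"
  proof (rule monoI)
    fix x y :: real assume "x \<le> y"
    then have "F (inv F x) \<le> F (inv F y)" using surj_f_inv_f[OF assms(2)] by simp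
    then show "inv F x \<le> inv F y" using strict_mono_less_eq[OF assms(1)] by blast
  qed
  moreover have "range (inv F) = UNIV"
    using inj_imp_surj_inv[OF strict_mono_imp_inj_on[OF assms(1)]] .
  ultimately show ?thesis
    by (intro continuous_onI_mono) (auto dest: monoD)
qed

text \<open>Isabelle's real square root is odd, so \<^term>\<open>sqrt (sin x)\<close> stands for
  \<open>sgn (sin x) |sin x|\<^bsup>1/2\<^esup>\<close>. Put \<open>\<phi>(t) = sqrt (sin \<theta>(t))\<close>; since the equation
  preserves \<open>\<phi>(t)\<^sup>4 + \<phi>(t + Q)\<^sup>4 = 1\<close>, the shift by \<open>Q\<close> must turn sine into cosine, and then
  \<open>\<theta>\<close> has to invert a primitive of \<open>3/2 |sin cos|\<^bsup>1/2\<^esup>\<close>.\<close>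

theorem oscillator_exists:
  obtains Q :: real and \<phi> :: "real \<Rightarrow> real" where "Q > 0" "continuous_on UNIV \<phi>"
    "\<And>t. ((\<lambda>t. \<phi> t ^ 3) has_real_derivative \<phi> (t + Q)) (at t)"
    "\<And>t. \<phi> (t + 2 * Q) = - \<phi> t" "\<And>t. \<bar>\<phi> t\<bar> \<le> 1" "\<phi> Q = 1"
proof -
  \<comment> \<open>The factor 3/2 is the exponent of the sine in \<open>\<phi>\<close>^3.\<close>
  define f :: "real \<Rightarrow> real" where "f x = 3/2 * sqrt \<bar>sin x * cos x\<bar>" for x
  have contf: "continuous_on UNIV f" unfolding f_def by (intro continuous_intros)
  obtain F0 where F0: "\<And>x. (F0 has_real_derivative f x) (at x)"
    using continuous_antiderivative_exists[OF contf] by blast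
  define F where "F x = F0 x - F0 0" for x
  have F: "(F has_real_derivative f x) (at x)" for x
    using DERIV_diff[OF F0[of x] DERIV_const[of "F0 0"]] by (simp add: F_def[abs_def])
  have F_0: "F 0 = 0" by (simp add: F_def)
  have contF: "isCont F x" for x using F DERIV_isCont by blast
  have mF: "F x \<le> F y" if "x \<le> y" for x y
  proof (rule DERIV_nonneg_imp_nondecreasing[OF that])
    show "\<exists>d. (F has_real_derivative d) (at z) \<and> 0 \<le> d" for z
      using F[of z] by (intro exI[of _ "f z"]) (simp add: f_def)
  qed
  have smF: "strict_mono F"
  proof (rule strict_monoI)
    fix x y :: real assume xy: "x < y"
    show "F x < F y"
    proof (rule ccontr)
      \<comment> \<open>If \<open>F\<close> were constant on an interval, sin(2z) would vanish
        throughout it, and so would its derivative 2 cos(2z); these have no common zero.\<close>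
      assume "\<not> F x < F y"
      then have const: "F z = F x" if "z \<in> {x<..<y}" for z
        using mF[of x z] mF[of z y] that by auto
      have f0: "sin (2 * z) = 0" if z: "z \<in> {x<..<y}" for z
      proof -
        have "(F has_real_derivative 0) (at z)"
          by (rule has_field_derivative_transform_within_open[of "\<lambda>_. F x" _ _ "{x<..<y}"])
             (use z const in auto)
        then have "f z = 0" using F DERIV_unique by blast
        then show ?thesis by (auto simp: f_def sin_double)
      qed
      obtain z where z: "z \<in> {x<..<y}" using xy dense by auto
      have "((\<lambda>z. sin (2 * z)) has_real_derivative 0) (at z)"
        by (rule has_field_derivative_transform_within_open[of "\<lambda>_. 0" _ _ "{x<..<y}"])
           (use z f0 in auto)
      moreover have "((\<lambda>z. sin (2 * z)) has_real_derivative cos (2 * z) * 2) (at z)"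
        by (auto intro!: derivative_eq_intros)
      ultimately have "cos (2 * z) = 0" using DERIV_unique by fastforce
      with f0[OF z] show False using sin_cos_squared_add[of "2 * z"] by simp
    qed
  qed
  \<comment> \<open>The time of a quarter turn. Since |sin cos| has period pi/2, every quarter turn
    takes this long.\<close>
  define Q where "Q = F (pi / 2)"
  have Qpos: "Q > 0" using strict_monoD[OF smF, of 0 "pi/2"] by (simp add: Q_def F_0)
  have Fshift: "F (x + pi / 2) = F x + Q" for x
  proof -
    have fp: "f (x + pi / 2) = f x" for x
      by (simp add: f_def sin_add cos_add abs_mult mult.commute)
    have "((\<lambda>x. F (x + pi / 2) - F x) has_real_derivative 0) (at x)" for x
      using DERIV_diff[OF DERIV_shift[THEN iffD1, OF F[of "x + pi/2"]] F[of x]] by (simp add: fp)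
    then have "F (x + pi / 2) - F x = F (0 + pi / 2) - F 0"
      using DERIV_isconst_all[of "\<lambda>x. F (x + pi / 2) - F x" x 0] by blast
    then show ?thesis by (simp add: Q_def F_0)
  qed
  have Fnat: "F (x + of_nat n * (pi / 2)) = F x + of_nat n * Q" for n x
  proof (induction n)
    case (Suc n)
    have "F (x + of_nat (Suc n) * (pi / 2)) = F ((x + of_nat n * (pi / 2)) + pi / 2)"
      by (simp add: algebra_simps add_divide_distrib)
    then show ?case using Suc by (simp only: Fshift) (simp add: algebra_simps)
  qed simp
  have surjF: "surj F"
    unfolding surj_def
  proof (rule allI)
    fix y
    obtain n where n: "\<bar>y\<bar> < of_nat n * Q" using reals_Archimedean3[OF Qpos] by blast
    have "F (of_nat n * (pi / 2)) = of_nat n * Q" using Fnat[of 0 n] by (simp add: F_0)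
    moreover have "F (- (of_nat n * (pi / 2))) = - (of_nat n * Q)"
      using Fnat[of "- (of_nat n * (pi / 2))" n] by (simp add: F_0)
    ultimately have "\<exists>x\<ge>- (of_nat n * (pi / 2)). x \<le> of_nat n * (pi / 2) \<and> F x = y"
      using n contF by (intro IVT) (auto simp: abs_less_iff)
    then show "\<exists>x. y = F x" by auto
  qed
  define \<theta> where "\<theta> = inv F"
  have F\<theta>: "F (\<theta> t) = t" for t using surj_f_inv_f[OF surjF] by (simp add: \<theta>_def)
  have \<theta>F: "\<theta> (F x) = x" for x using strict_mono_imp_inj_on[OF smF] by (simp add: \<theta>_def)
  have cont\<theta>: "continuous_on A \<theta>" for A
    using continuous_inverse_of_increasing_bijection[OF smF surjF] continuous_on_subset
    unfolding \<theta>_def by blast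
  have \<theta>shift: "\<theta> (t + Q) = \<theta> t + pi / 2" for t
    using \<theta>F[of "\<theta> t + pi / 2"] by (simp add: Fshift F\<theta>)
  define \<phi> where "\<phi> t = sqrt (sin (\<theta> t))" for t
  have \<phi>Q: "\<phi> (t + Q) = sqrt (cos (\<theta> t))" for t
    by (simp add: \<phi>_def \<theta>shift sin_add)
  have cont\<phi>: "continuous_on A \<phi>" for A
    unfolding \<phi>_def by (intro continuous_intros cont\<theta>)
  \<comment> \<open>At these times f(\<theta>) = 0, so the inverse \<open>\<theta>\<close> of
    \<open>F\<close> has a vertical tangent and cannot be differentiated.\<close>
  define S where "S = {t. sin (\<theta> t) * cos (\<theta> t) = 0}"
  have finS: "finite (S \<inter> {-r..r})" for r
  proof -
    define N where "N = {i::int. 2 * \<theta> (-r) \<le> of_int i * pi \<and> of_int i * pi \<le> 2 * \<theta> r}"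
    have "N \<subseteq> {\<lfloor>2 * \<theta> (-r) / pi\<rfloor>..\<lceil>2 * \<theta> r / pi\<rceil>}"
    proof
      fix i assume "i \<in> N"
      then have "2 * \<theta> (-r) / pi \<le> of_int i" "of_int i \<le> 2 * \<theta> r / pi"
        by (auto simp: N_def field_simps)
      then show "i \<in> {\<lfloor>2 * \<theta> (-r) / pi\<rfloor>..\<lceil>2 * \<theta> r / pi\<rceil>}"
        by (auto simp: floor_le_iff le_ceiling_iff)
    qed
    then have "finite ((\<lambda>i. F (of_int i * pi / 2)) ` N)"
      by (meson finite_atLeastAtMost_int finite_imageI finite_subset)
    moreover have "S \<inter> {-r..r} \<subseteq> (\<lambda>i. F (of_int i * pi / 2)) ` N"
    proof
      fix t assume t: "t \<in> S \<inter> {-r..r}"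
      then have "sin (2 * \<theta> t) = 0" by (auto simp: S_def sin_double)
      then obtain i :: int where i: "2 * \<theta> t = of_int i * pi" by (auto simp: sin_zero_iff_int2)
      have "\<theta> (-r) \<le> \<theta> t" "\<theta> t \<le> \<theta> r"
        using t strict_mono_less_eq[OF smF, of "\<theta> (-r)" "\<theta> t"]
          strict_mono_less_eq[OF smF, of "\<theta> t" "\<theta> r"] by (simp_all add: F\<theta>)
      then have "i \<in> N" using i by (simp add: N_def)
      moreover have "t = F (of_int i * pi / 2)" using F\<theta>[of t] by (simp flip: i)
      ultimately show "t \<in> (\<lambda>i. F (of_int i * pi / 2)) ` N" by blast
    qed
    ultimately show ?thesis by (rule finite_subset[rotated])
  qed
  have "((\<lambda>t. \<phi> t ^ 3) has_real_derivative \<phi> (t + Q)) (at t)" for t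
  proof (rule has_derivative_off_locally_finite[OF _ _ finS])
    show "continuous_on UNIV (\<lambda>t. \<phi> t ^ 3)" by (intro continuous_intros cont\<phi>)
    show "continuous_on UNIV (\<lambda>t. \<phi> (t + Q))"
      by (intro continuous_on_compose2[OF cont\<phi>[of UNIV]] continuous_intros) auto
    fix t assume "t \<notin> S"
    then have sc: "sin (\<theta> t) \<noteq> 0" "cos (\<theta> t) \<noteq> 0" by (auto simp: S_def)
    have f0: "f (\<theta> t) \<noteq> 0" using sc by (simp add: f_def)
    have D\<theta>: "(\<theta> has_real_derivative inverse (f (\<theta> t))) (at t)"
    proof (rule DERIV_inverse_function[where f = F and a = "t - 1" and b = "t + 1"])
      show "isCont \<theta> t" using cont\<theta>[of UNIV] by (simp add: continuous_on_eq_continuous_at)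
    qed (use F f0 F\<theta> in auto)
    \<comment> \<open>For the odd square root the derivative at a negative x is -1/(2 sqrt x), which
      is positive; \<open>e\<close> carries this sign.\<close>
    define e where "e = sgn (sin (\<theta> t))"
    have Dsq: "(sqrt has_real_derivative e * inverse (sqrt (sin (\<theta> t))) / 2) (at (sin (\<theta> t)))"
      using sc by (intro DERIV_real_sqrt_generic) (auto simp: e_def sgn_if)
    have "((\<lambda>t. sqrt (sin (\<theta> t))) has_real_derivative
        (e * inverse (sqrt (sin (\<theta> t))) / 2) * (cos (\<theta> t) * inverse (f (\<theta> t)))) (at t)"
      by (rule DERIV_chain2[where f = sqrt and g = "\<lambda>t. sin (\<theta> t)"], rule Dsq)
        (rule DERIV_chain2[where f = sin and g = \<theta>], rule DERIV_sin, rule D\<theta>)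
    from DERIV_power[OF this, of 3]
    have D: "((\<lambda>t. \<phi> t ^ 3) has_real_derivative 3 * (sqrt (sin (\<theta> t)))\<^sup>2 *
        ((e * inverse (sqrt (sin (\<theta> t))) / 2) * (cos (\<theta> t) * inverse (f (\<theta> t))))) (at t)"
      by (simp add: \<phi>_def algebra_simps)
    have "3 * (sqrt (sin (\<theta> t)))\<^sup>2 *
        ((e * inverse (sqrt (sin (\<theta> t))) / 2) * (cos (\<theta> t) * inverse (f (\<theta> t)))) = \<phi> (t + Q)"
    proof -
      \<comment> \<open>With the signed roots A and B the cosine is B |B| and f(\<theta>) is (3/2)
        |A| |B|, so the derivative of the cube collapses to B in all four sign cases.\<close>
      define A B where "A = sqrt (sin (\<theta> t))" and "B = sqrt (cos (\<theta> t))"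
      have A0: "A \<noteq> 0" "B \<noteq> 0" using sc by (auto simp: A_def B_def)
      have sqrt_abs: "sqrt \<bar>x\<bar> = \<bar>sqrt x\<bar>" for x :: real
        by (simp add: abs_if real_sqrt_minus)
      have fA: "f (\<theta> t) = 3/2 * (\<bar>A\<bar> * \<bar>B\<bar>)"
        by (simp add: f_def A_def B_def abs_mult real_sqrt_mult sqrt_abs)
      have "cos (\<theta> t) = B * \<bar>B\<bar>"
        by (cases "cos (\<theta> t) \<ge> 0") (auto simp: B_def abs_if real_sqrt_mult_self)
      moreover have "e = sgn A" by (auto simp: e_def A_def sgn_if)
      ultimately have "3 * A\<^sup>2 * ((e * inverse A / 2) * (cos (\<theta> t) * inverse (f (\<theta> t)))) = B"
        using A0 unfolding fA by (simp add: field_simps power2_eq_square sgn_if)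
      then show ?thesis unfolding \<phi>Q A_def B_def .
    qed
    with D show "((\<lambda>t. \<phi> t ^ 3) has_real_derivative \<phi> (t + Q)) (at t)" by simp
  qed
  moreover have "\<phi> (t + 2 * Q) = - \<phi> t" for t
  proof -
    have "\<theta> (t + 2 * Q) = \<theta> t + pi"
      using \<theta>shift[of "t + Q"] \<theta>shift[of t] by (simp add: algebra_simps)
    then show ?thesis by (simp add: \<phi>_def real_sqrt_minus)
  qed
  moreover have "\<bar>\<phi> t\<bar> \<le> 1" for t
  proof -
    have "sqrt (sin (\<theta> t)) \<le> sqrt 1" "sqrt (- 1) \<le> sqrt (sin (\<theta> t))"
      by (simp_all only: real_sqrt_le_iff sin_le_one sin_ge_minus_one)
    then show ?thesis by (simp add: \<phi>_def real_sqrt_minus abs_le_iff)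
  qed
  moreover have "\<phi> Q = 1" using \<phi>Q[of 0] \<theta>F[of 0] by (simp add: F_0)
  ultimately show ?thesis using that[OF Qpos cont\<phi>] by blast
qed

section \<open>Waves in layered media\<close>

lemma L2D_exponential_decay:
  assumes f: "f \<in> borel_measurable borel" and \<rho>: "\<rho> > 0"
    and bd: "\<And>z. \<bar>f z\<bar> \<le> C * exp (- \<rho> * \<bar>fst z\<bar>)"
  shows "L2D T f"
proof -
  obtain K where K: "\<And>x. exp (- (2 * \<rho>) * \<bar>x\<bar>) \<le> K * inverse (1 + x\<^sup>2)"
    using exp_minus_le_inverse_one_plus_square[of "2 * \<rho>"] \<rho> by auto
  have "set_integrable lborel (Dset T) (\<lambda>z. (f z)\<^sup>2)"
  proof (rule set_integrable_Dset)
    show "(\<lambda>z. (f z)\<^sup>2) \<in> borel_measurable borel" using f by simp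
    fix x t :: real
    have "(f (x, t))\<^sup>2 \<le> (C * exp (- \<rho> * \<bar>x\<bar>))\<^sup>2"
      using bd[of "(x, t)"] by (simp add: abs_le_square_iff[symmetric])
    also have "\<dots> = C\<^sup>2 * exp (- (2 * \<rho>) * \<bar>x\<bar>)"
      by (simp add: power_mult_distrib power2_eq_square exp_add[symmetric])
    also have "\<dots> \<le> C\<^sup>2 * (K * inverse (1 + x\<^sup>2))"
      by (intro mult_left_mono K) auto
    finally show "\<bar>(f (x, t))\<^sup>2\<bar> \<le> (C\<^sup>2 * K) * inverse (1 + x\<^sup>2)" by simp
  qed
  then show ?thesis using f by (simp add: L2D_def)
qed

lemma AE_fst_notin_countable:
  fixes N :: "real set"
  assumes "countable N"
  shows "AE z in (lborel :: (real \<times> real) measure). fst z \<notin> N"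
proof (rule AE_I'[of "N \<times> UNIV"])
  have [measurable]: "N \<in> sets borel" by (rule sets.countable[OF _ assms]) simp
  have "emeasure (lborel \<Otimes>\<^sub>M lborel) (N \<times> (UNIV :: real set)) = emeasure lborel N * emeasure lborel (UNIV :: real set)"
    by (rule lborel.emeasure_pair_measure_Times) auto
  also have "\<dots> = 0" using assms by (simp add: emeasure_lborel_countable)
  finally have "N \<times> (UNIV :: real set) \<in> null_sets (lborel \<Otimes>\<^sub>M lborel)"
    by (intro null_setsI) auto
  then show "N \<times> (UNIV :: real set) \<in> null_sets lborel" by (simp add: lborel_prod)
qed auto

lemma integral_by_parts_periodic:
  fixes f h :: "real \<Rightarrow> real"
  assumes "\<And>t. (f has_real_derivative f' t) (at t)" "\<And>t. (h has_real_derivative h' t) (at t)"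
    and "continuous_on UNIV f'" "continuous_on UNIV h'"
    and "f T = f 0" "h T = h 0" "T \<ge> 0"
  shows "(LINT t:{0..T}|lborel. f t * h' t) = - (LINT t:{0..T}|lborel. f' t * h t)"
proof -
  have cf: "continuous_on A f" for A
    by (rule DERIV_continuous_on[of _ f f']) (auto intro: has_field_derivative_at_within assms)
  have ch: "continuous_on A h" for A
    by (rule DERIV_continuous_on[of _ h h']) (auto intro: has_field_derivative_at_within assms)
  have c1: "continuous_on {0..T} (\<lambda>t. f t * h' t)" and c2: "continuous_on {0..T} (\<lambda>t. f' t * h t)"
    by (intro continuous_intros cf ch continuous_on_subset[OF assms(3)] continuous_on_subset[OF assms(4)]; simp)+
  have "((\<lambda>t. f t * h t) has_real_derivative f' t * h t + f t * h' t) (at t)" for t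
    using DERIV_mult[OF assms(1)[of t] assms(2)[of t]] by (simp add: algebra_simps)
  from integral_derivative[OF this assms(7)]
  have "integral {0..T} (\<lambda>t. f' t * h t + f t * h' t) = 0"
    using assms(5,6) by simp
  also have "integral {0..T} (\<lambda>t. f' t * h t + f t * h' t)
      = integral {0..T} (\<lambda>t. f' t * h t) + integral {0..T} (\<lambda>t. f t * h' t)"
    by (intro Henstock_Kurzweil_Integration.integral_add integrable_continuous_interval c1 c2)
  finally show ?thesis
    using set_lborel_integral_continuous[OF c1] set_lborel_integral_continuous[OF c2] by simp
qed

lemma continuous_Lp_torus:
  assumes "continuous_on UNIV u"
  shows "Lp_torus p T u"
proof -
  have "integrable lborel (\<lambda>t. indicator {0..T} t *\<^sub>R \<bar>u t\<bar> ^ p)"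
  proof (rule borel_integrable_compact)
    show "continuous_on {0..T} (\<lambda>t. \<bar>u t\<bar> ^ p)"
      by (intro continuous_intros continuous_on_subset[OF assms]) simp
  qed simp
  moreover have "u \<in> borel_measurable lborel"
    using borel_measurable_continuous_onI[OF assms] by simp
  ultimately show ?thesis
    unfolding Lp_torus_def set_integrable_def by (rule conjI[rotated])
qed

text \<open>Uniform continuity on a compact neighbourhood of the line x = 0 makes the squared error
  uniformly small, and averaging over the thin strip preserves this.\<close>

lemma continuous_is_trace0:
  assumes w: "continuous_on UNIV w" and T: "T > 0"
  shows "is_trace0 T w (\<lambda>t. w (0, t))"
proof -
  have cw: "continuous_on A (\<lambda>t. w (0, t))" for A
    by (intro continuous_on_compose2[OF w] continuous_intros) auto
  have "Lp_torus 2 T (\<lambda>t. w (0, t))"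
    by (rule continuous_Lp_torus[OF cw])
  moreover have "((\<lambda>\<epsilon>. (1 / (2 * \<epsilon>)) *
      (LINT z:{-\<epsilon>..\<epsilon>} \<times> {0..T}|lborel. (w z - w (0, snd z))\<^sup>2)) \<longlongrightarrow> 0) (at_right 0)"
  proof (rule tendstoI)
    fix e :: real assume e: "e > 0"
    \<comment> \<open>The averaged squared error is at most \<eta>^2 T, which is e/2 for this
      choice.\<close>
    define \<eta> where "\<eta> = sqrt (e / (2 * T))"
    have \<eta>: "\<eta> > 0" "\<eta>\<^sup>2 * T = e / 2" using e T by (auto simp: \<eta>_def)
    have "uniformly_continuous_on ({-1..1} \<times> {0..T}) w"
      by (intro compact_uniformly_continuous continuous_on_subset[OF w] compact_Times) auto
    then obtain \<delta> where \<delta>: "\<delta> > 0"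
      "\<And>z z'. z \<in> {-1..1} \<times> {0..T} \<Longrightarrow> z' \<in> {-1..1} \<times> {0..T} \<Longrightarrow> dist z' z < \<delta> \<Longrightarrow> dist (w z') (w z) < \<eta>"
      using \<eta>(1) unfolding uniformly_continuous_on_def by metis
    have "dist ((1 / (2 * \<epsilon>)) * (LINT z:{-\<epsilon>..\<epsilon>} \<times> {0..T}|lborel. (w z - w (0, snd z))\<^sup>2)) 0 < e"
      if \<epsilon>: "0 < \<epsilon>" "\<epsilon> < min 1 \<delta>" for \<epsilon>
    proof -
      let ?h = "\<lambda>z. (w z - w (0, snd z))\<^sup>2"
      have box: "{-\<epsilon>..\<epsilon>} \<times> {0..T} = cbox (-\<epsilon>, 0) (\<epsilon>, T)" by (auto simp: cbox_Pair_eq)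
      have ch: "continuous_on A ?h" for A
        by (intro continuous_intros continuous_on_compose2[OF w] continuous_on_subset[OF w]) auto
      have eq: "(LINT z:{-\<epsilon>..\<epsilon>} \<times> {0..T}|lborel. ?h z) = integral (cbox (-\<epsilon>, 0) (\<epsilon>, T)) ?h"
        unfolding box
        by (rule set_borel_integral_eq_integral)
           (use borel_integrable_compact[OF compact_cbox ch] in \<open>simp add: set_integrable_def\<close>)
      have "norm (integral (cbox (-\<epsilon>, 0) (\<epsilon>, T)) ?h) \<le> \<eta>\<^sup>2 * measure lborel (cbox (-\<epsilon>, 0) (\<epsilon>, T))"
      proof (rule has_integral_bound[OF _ integrable_integral[OF integrable_continuous[OF ch]]])
        fix z assume z: "z \<in> cbox (-\<epsilon>, 0) (\<epsilon>, T)"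
        obtain x t where xt: "z = (x, t)" by (cases z)
        have "dist z (0, t) < \<delta>" using z \<epsilon> by (auto simp: xt dist_Pair_Pair dist_real_def)
        then have "\<bar>w z - w (0, snd z)\<bar> \<le> \<eta>"
          using \<delta>(2)[of "(0, t)" z] z \<epsilon> by (auto simp: xt dist_real_def)
        then show "norm (?h z) \<le> \<eta>\<^sup>2" by (simp add: abs_le_square_iff[symmetric])
      qed simp
      also have "\<dots> = \<eta>\<^sup>2 * (2 * \<epsilon> * T)"
        using \<epsilon> T by (simp add: content_Pair)
      finally have "(1 / (2 * \<epsilon>)) * \<bar>integral (cbox (-\<epsilon>, 0) (\<epsilon>, T)) ?h\<bar> \<le> \<eta>\<^sup>2 * T"
        using \<epsilon> by (simp add: field_simps)
      then show ?thesis unfolding eq using \<epsilon> e \<eta>(2) by (simp add: abs_mult)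
    qed
    then show "\<forall>\<^sub>F \<epsilon> in at_right 0. dist ((1 / (2 * \<epsilon>)) *
        (LINT z:{-\<epsilon>..\<epsilon>} \<times> {0..T}|lborel. (w z - w (0, snd z))\<^sup>2)) 0 < e"
      using \<delta>(1) by (intro eventually_at_rightI[of 0 "min 1 \<delta>"]) auto
  qed
  ultimately show ?thesis by (simp add: is_trace0_def)
qed

lemma smooth1_derivative:
  assumes "smooth1 f"
  shows "(f has_real_derivative deriv f x) (at x)" "continuous_on UNIV (deriv f)"
proof -
  have d: "f differentiable (at x)" "smooth1 (deriv f)" for x
    using assms by (auto elim: smooth1.cases)
  have d': "deriv f differentiable (at x)" for x
    using d(2) by (auto elim: smooth1.cases)
  show "(f has_real_derivative deriv f x) (at x)"
    using d(1) by (simp add: DERIV_deriv_iff_real_differentiable)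
  show "continuous_on UNIV (deriv f)"
    using d' by (auto simp: continuous_on_eq_continuous_at intro: differentiable_imp_continuous_within)
qed

text \<open>Even waves \<open>\<alpha>(x) (U(t - \<xi>(x)) + \<sigma> U(t + \<xi>(x)))\<close>: in each layer the amplitude \<open>\<alpha>\<close> is constant
  and \<open>\<xi>\<close> is the travel time, of slope \<open>s = g\<^bsup>1/2\<^esup>\<close>. The amplitude may jump at an interface, as long
  as the wave and its flux \<open>\<plusminus>w\<^sub>x\<close> stay continuous.\<close>

locale layered_wave =
  fixes T :: real and s \<xi> \<alpha> U V :: "real \<Rightarrow> real" and \<sigma> M \<rho> B :: real and S :: "real set"
  assumes T_pos: "T > 0"
    and dU: "\<And>t. (U has_real_derivative V t) (at t)"
    and contV: "continuous_on UNIV V"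
    and perU: "\<And>t. U (t + T) = U t" and perV: "\<And>t. V (t + T) = V t"
    and bdUV: "\<And>t. \<bar>U t\<bar> \<le> B" "\<And>t. \<bar>V t\<bar> \<le> B"
    and abs_\<sigma>: "\<bar>\<sigma>\<bar> = 1"
    and finS: "\<And>r. finite (S \<inter> {-r..r})" and zero_S: "0 \<in> S"
    and locally_affine: "\<And>x. x \<notin> S \<Longrightarrow> \<exists>d>0. \<forall>y. \<bar>y - x\<bar> < d \<longrightarrow>
      \<alpha> y = \<alpha> x \<and> s y = s x \<and> \<xi> y = \<xi> x + sgn x * s x * (y - x)"
    and decay: "\<rho> > 0" "\<And>x. \<bar>\<alpha> x\<bar> \<le> M * exp (- \<rho> * \<bar>x\<bar>)"
    and bds: "\<And>x. \<bar>s x\<bar> \<le> B"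
    and contw: "continuous_on UNIV
      (\<lambda>z. \<alpha> (fst z) * (U (snd z - \<xi> (fst z)) + \<sigma> * U (snd z + \<xi> (fst z))))"
    and contq: "continuous_on UNIV
      (\<lambda>z. \<alpha> (fst z) * s (fst z) * (- V (snd z - \<xi> (fst z)) + \<sigma> * V (snd z + \<xi> (fst z))))"
begin

definition w :: "real \<times> real \<Rightarrow> real" where
  "w z = \<alpha> (fst z) * (U (snd z - \<xi> (fst z)) + \<sigma> * U (snd z + \<xi> (fst z)))"

text \<open>The derivative of the wave in the direction away from the origin. It is continuous
  across x = 0, whereas \<open>wx\<close> jumps there by twice its value.\<close>

definition flux :: "real \<times> real \<Rightarrow> real" where
  "flux z = \<alpha> (fst z) * s (fst z) * (- V (snd z - \<xi> (fst z)) + \<sigma> * V (snd z + \<xi> (fst z)))"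

definition wx :: "real \<times> real \<Rightarrow> real" where
  "wx z = sgn (fst z) * flux z"

definition wt :: "real \<times> real \<Rightarrow> real" where
  "wt z = \<alpha> (fst z) * (V (snd z - \<xi> (fst z)) + \<sigma> * V (snd z + \<xi> (fst z)))"

text \<open>The three coefficients may jump on \<open>S\<close>, but \<open>S\<close> is countable,
  being locally finite, and off \<open>S\<close> they are locally constant or affine.\<close>

lemma meas: "\<alpha> \<in> borel_measurable borel" "s \<in> borel_measurable borel" "\<xi> \<in> borel_measurable borel"
proof -
  have "S \<subseteq> (\<Union>n::nat. S \<inter> {- real n..real n})"
  proof
    fix x assume "x \<in> S"
    moreover obtain n where "\<bar>x\<bar> \<le> real n" using real_arch_simple by blast
    ultimately have "x \<in> S \<inter> {- real n..real n}" by auto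
    then show "x \<in> (\<Union>n::nat. S \<inter> {- real n..real n})" by blast
  qed
  then have S: "countable S"
    by (rule countable_subset) (rule countable_UN, simp, rule countable_finite, rule finS)
  have "isCont \<alpha> x \<and> isCont s x \<and> isCont \<xi> x" if x: "x \<notin> S" for x
  proof -
    obtain d where d: "d > 0" "\<And>y. \<bar>y - x\<bar> < d \<Longrightarrow> \<alpha> y = \<alpha> x \<and> s y = s x \<and> \<xi> y = \<xi> x + sgn x * s x * (y - x)"
      using locally_affine[OF x] by blast
    have "\<forall>\<^sub>F y in nhds x. \<bar>y - x\<bar> < d"
      using d(1) eventually_nhds_metric dist_real_def by metis
    then have "\<forall>\<^sub>F y in nhds x. \<alpha> y = \<alpha> x" "\<forall>\<^sub>F y in nhds x. s y = s x"
        "\<forall>\<^sub>F y in nhds x. \<xi> y = \<xi> x + sgn x * s x * (y - x)"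
      by (eventually_elim, use d(2) in blast)+
    then show ?thesis
      by (auto simp: isCont_cong)
  qed
  then have "continuous_on (- S) \<alpha>" "continuous_on (- S) s" "continuous_on (- S) \<xi>"
    by (auto simp: continuous_at_imp_continuous_on)
  then show "\<alpha> \<in> borel_measurable borel" "s \<in> borel_measurable borel" "\<xi> \<in> borel_measurable borel"
    using borel_measurable_continuous_countable_exceptions[OF S] by auto
qed

lemma continuous_w: "continuous_on A w"
  using contw continuous_on_subset unfolding w_def by blast

lemma continuous_flux: "continuous_on A flux"
  using contq continuous_on_subset unfolding flux_def by blast

lemma continuous_wt: "continuous_on A (\<lambda>t. wt (x, t))"
  unfolding wt_def by (intro continuous_intros continuous_on_compose2[OF contV]) auto

lemma continuous_flux_section: "continuous_on A (\<lambda>t. flux (x, t))"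
  by (intro continuous_on_compose2[OF continuous_flux[of UNIV]] continuous_intros) auto

lemma measurable_w: "w \<in> borel_measurable borel" "flux \<in> borel_measurable borel"
  by (auto intro!: borel_measurable_continuous_onI continuous_w continuous_flux)

lemma measurable_fst_comp: "f \<in> borel_measurable borel \<Longrightarrow> (\<lambda>z::real \<times> real. f (fst z) :: real) \<in> borel_measurable borel"
  by (rule measurable_compose[OF borel_measurable_continuous_onI[OF continuous_on_fst[OF continuous_on_id]]])

lemma measurable_wx: "wx \<in> borel_measurable borel"
  unfolding wx_def by (intro borel_measurable_times measurable_fst_comp measurable_w) simp

lemma measurable_wt: "wt \<in> borel_measurable borel"
proof -
  have V: "V \<in> borel_measurable borel" by (rule borel_measurable_continuous_onI[OF contV])
  have s: "(\<lambda>z::real \<times> real. snd z) \<in> borel_measurable borel"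
    by (rule borel_measurable_continuous_onI[OF continuous_on_snd[OF continuous_on_id]])
  note x = measurable_fst_comp[OF meas(3)]
  have "(\<lambda>z. V (snd z - \<xi> (fst z))) \<in> borel_measurable borel"
    "(\<lambda>z. V (snd z + \<xi> (fst z))) \<in> borel_measurable borel"
    using measurable_compose[OF borel_measurable_diff[OF s x] V]
      measurable_compose[OF borel_measurable_add[OF s x] V] by auto
  then show ?thesis
    unfolding wt_def using measurable_fst_comp[OF meas(1)] by simp
qed

lemma exponential_decay:
  obtains C where "C > 0" "\<And>z. \<bar>w z\<bar> \<le> C * exp (- \<rho> * \<bar>fst z\<bar>)"
    "\<And>z. \<bar>wx z\<bar> \<le> C * exp (- \<rho> * \<bar>fst z\<bar>)" "\<And>z. \<bar>wt z\<bar> \<le> C * exp (- \<rho> * \<bar>fst z\<bar>)"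
proof -
  have M0: "M \<ge> 0" using decay(2)[of 0] by simp
  have B0: "B \<ge> 0" using bdUV(1)[of 0] by linarith
  \<comment> \<open>The factor 1 + B bounds both the factor 1 in \<open>w\<close> and
    \<open>wt\<close> and the factor \<open>s\<close> in \<open>wx\<close>; 2 B bounds the sum of
    the two travelling parts, and the final 1 makes the constant positive.\<close>
  define C where "C = M * (1 + B) * (2 * B) + 1"
  have sum_le: "\<bar>a + \<sigma> * b\<bar> \<le> 2 * B" if "\<bar>a\<bar> \<le> B" "\<bar>b\<bar> \<le> B" for a b
    using that abs_triangle_ineq[of a "\<sigma> * b"] by (simp add: abs_mult abs_\<sigma>)
  have key: "\<bar>\<alpha> x * k * y\<bar> \<le> C * exp (- \<rho> * \<bar>x\<bar>)" if "\<bar>k\<bar> \<le> 1 + B" "\<bar>y\<bar> \<le> 2 * B" for x k y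
  proof -
    have "\<bar>\<alpha> x * k * y\<bar> = \<bar>\<alpha> x\<bar> * (\<bar>k\<bar> * \<bar>y\<bar>)" by (simp add: abs_mult)
    also have "\<dots> \<le> (M * exp (- \<rho> * \<bar>x\<bar>)) * ((1 + B) * (2 * B))"
      using that B0 M0 by (intro mult_mono decay) auto
    also have "\<dots> = (M * (1 + B) * (2 * B)) * exp (- \<rho> * \<bar>x\<bar>)" by simp
    also have "\<dots> \<le> C * exp (- \<rho> * \<bar>x\<bar>)" by (intro mult_right_mono) (auto simp: C_def)
    finally show ?thesis .
  qed
  have "\<bar>w z\<bar> \<le> C * exp (- \<rho> * \<bar>fst z\<bar>)" for z
    using key[of 1 "U (snd z - \<xi> (fst z)) + \<sigma> * U (snd z + \<xi> (fst z))" "fst z"] B0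
    by (simp add: w_def sum_le bdUV)
  moreover have "\<bar>wt z\<bar> \<le> C * exp (- \<rho> * \<bar>fst z\<bar>)" for z
    using key[of 1 "V (snd z - \<xi> (fst z)) + \<sigma> * V (snd z + \<xi> (fst z))" "fst z"] B0
    by (simp add: wt_def sum_le bdUV)
  moreover have "\<bar>wx z\<bar> \<le> C * exp (- \<rho> * \<bar>fst z\<bar>)" for z
  proof -
    have "\<bar>wx z\<bar> \<le> \<bar>flux z\<bar>" by (simp add: wx_def abs_mult sgn_if)
    also have "\<dots> \<le> C * exp (- \<rho> * \<bar>fst z\<bar>)"
      unfolding flux_def using bds[of "fst z"] by (intro key sum_le) (auto simp: bdUV)
    finally show ?thesis .
  qed
  moreover have "C > 0" using M0 B0 by (simp add: C_def add_nonneg_pos)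
  ultimately show ?thesis using that by blast
qed

lemma bounded_fields:
  obtains C where "\<And>z. \<bar>w z\<bar> \<le> C" "\<And>z. \<bar>wx z\<bar> \<le> C" "\<And>z. \<bar>wt z\<bar> \<le> C"
proof -
  obtain C where C: "C > 0" "\<And>z. \<bar>w z\<bar> \<le> C * exp (- \<rho> * \<bar>fst z\<bar>)"
    "\<And>z. \<bar>wx z\<bar> \<le> C * exp (- \<rho> * \<bar>fst z\<bar>)" "\<And>z. \<bar>wt z\<bar> \<le> C * exp (- \<rho> * \<bar>fst z\<bar>)"
    using exponential_decay by blast
  have le: "C * exp (- \<rho> * \<bar>x\<bar>) \<le> C" for x
    using C(1) decay(1) by (intro mult_right_le_one_le) auto
  show ?thesis
    by (rule that[of C]; rule order_trans[OF C(2) le] order_trans[OF C(3) le] order_trans[OF C(4) le])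
qed

lemma L2D_fields: "L2D T w" "L2D T wx" "L2D T wt"
proof -
  obtain C where "C > 0" and C: "\<And>z. \<bar>w z\<bar> \<le> C * exp (- \<rho> * \<bar>fst z\<bar>)"
    "\<And>z. \<bar>wx z\<bar> \<le> C * exp (- \<rho> * \<bar>fst z\<bar>)" "\<And>z. \<bar>wt z\<bar> \<le> C * exp (- \<rho> * \<bar>fst z\<bar>)"
    using exponential_decay by blast
  show "L2D T w" by (rule L2D_exponential_decay[OF measurable_w(1) decay(1) C(1)])
  show "L2D T wx" by (rule L2D_exponential_decay[OF measurable_wx decay(1) C(2)])
  show "L2D T wt" by (rule L2D_exponential_decay[OF measurable_wt decay(1) C(3)])
qed

lemma periodic_w: "w (x, t + T) = w (x, t)" and periodic_wt: "wt (x, t + T) = wt (x, t)"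
proof -
  have eq: "t + T - \<xi> x = (t - \<xi> x) + T" "t + T + \<xi> x = (t + \<xi> x) + T" by simp_all
  show "w (x, t + T) = w (x, t)" "wt (x, t + T) = wt (x, t)"
    by (simp_all only: w_def wt_def fst_conv snd_conv eq perU perV)
qed

lemma dw_dt: "((\<lambda>t. w (x, t)) has_real_derivative wt (x, t)) (at t)"
proof -
  have "((\<lambda>t. U (t - \<xi> x)) has_real_derivative V (t - \<xi> x)) (at t)"
    using DERIV_shift[THEN iffD1, OF dU[of "t + - \<xi> x"]] by simp
  moreover have "((\<lambda>t. U (t + \<xi> x)) has_real_derivative V (t + \<xi> x)) (at t)"
    by (rule DERIV_shift[THEN iffD1, OF dU])
  ultimately show ?thesis
    unfolding w_def wt_def fst_conv snd_conv by (intro DERIV_cmult DERIV_add)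
qed

lemma dw_dx:
  assumes "x \<notin> S"
  shows "((\<lambda>x. w (x, t)) has_real_derivative wx (x, t)) (at x)"
proof -
  define k where "k = sgn x * s x"
  obtain d where d: "d > 0" "\<And>y. \<bar>y - x\<bar> < d \<Longrightarrow> \<alpha> y = \<alpha> x \<and> s y = s x \<and> \<xi> y = \<xi> x + k * (y - x)"
    using locally_affine[OF assms] unfolding k_def by blast
  have D1: "((\<lambda>y. U (t - (\<xi> x + k * (y - x)))) has_real_derivative V (t - (\<xi> x + k * (x - x))) * (- k)) (at x)"
    by (rule DERIV_chain2[where f = U and g = "\<lambda>y. t - (\<xi> x + k * (y - x))"], rule dU)
       (auto intro!: derivative_eq_intros)
  have D2: "((\<lambda>y. U (t + (\<xi> x + k * (y - x)))) has_real_derivative V (t + (\<xi> x + k * (x - x))) * k) (at x)"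
    by (rule DERIV_chain2[where f = U and g = "\<lambda>y. t + (\<xi> x + k * (y - x))"], rule dU)
       (auto intro!: derivative_eq_intros)
  have D: "((\<lambda>y. \<alpha> x * (U (t - (\<xi> x + k * (y - x))) + \<sigma> * U (t + (\<xi> x + k * (y - x)))))
     has_real_derivative wx (x, t)) (at x)"
    by (rule DERIV_cong[OF DERIV_cmult[OF DERIV_add[OF D1 DERIV_cmult[OF D2]]]])
       (simp add: wx_def flux_def k_def algebra_simps)
  show ?thesis
  proof (rule has_field_derivative_transform_within_open[OF D, of "ball x d"])
    fix y assume "y \<in> ball x d"
    then have "\<bar>y - x\<bar> < d" by (simp add: dist_real_def abs_minus_commute)
    from d(2)[OF this]
    show "\<alpha> x * (U (t - (\<xi> x + k * (y - x))) + \<sigma> * U (t + (\<xi> x + k * (y - x)))) = w (y, t)"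
      unfolding w_def fst_conv snd_conv by (elim conjE) (simp only:)
  qed (simp_all add: d(1))
qed

text \<open>Piecewise classical derivatives are weak ones here: in x the wave is continuous at the
  interfaces, so they contribute nothing, and in t the boundary terms cancel by periodicity.\<close>

lemma weak_derivs_w: "weak_derivs T w wx wt"
  unfolding weak_derivs_def
proof (intro allI impI conjI)
  fix \<psi> assume \<psi>: "test_fun T \<psi>"
  note tp = test_fun_partials[OF \<psi>] and sm = test_fun_smooth2[OF \<psi>]
  obtain R where R: "\<And>x t. R < \<bar>x\<bar> \<Longrightarrow> \<psi> (x, t) = 0"
    using \<psi> unfolding test_fun_def by blast
  obtain R' where R': "\<And>x t. R' < \<bar>x\<bar> \<Longrightarrow> px \<psi> (x, t) = 0"
    using tp(1) unfolding test_fun_def by blast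
  obtain C where C: "\<And>z. \<bar>w z\<bar> \<le> C" "\<And>z. \<bar>wx z\<bar> \<le> C" "\<And>z. \<bar>wt z\<bar> \<le> C"
    using bounded_fields by blast
  obtain C1 where m1: "(\<lambda>z. w z * px \<psi> z) \<in> borel_measurable borel"
    and b1: "\<And>x t. t \<in> {0..T} \<Longrightarrow> \<bar>w (x, t) * px \<psi> (x, t)\<bar> \<le> C1 * inverse (1 + x\<^sup>2)"
    using mult_test_fun_bound[OF measurable_w(1) C(1) tp(1)] by blast
  obtain C2 where m2: "(\<lambda>z. wx z * \<psi> z) \<in> borel_measurable borel"
    and b2: "\<And>x t. t \<in> {0..T} \<Longrightarrow> \<bar>wx (x, t) * \<psi> (x, t)\<bar> \<le> C2 * inverse (1 + x\<^sup>2)"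
    using mult_test_fun_bound[OF measurable_wx C(2) \<psi>] by blast
  obtain C3 where m3: "(\<lambda>z. w z * pt \<psi> z) \<in> borel_measurable borel"
    and b3: "\<And>x t. t \<in> {0..T} \<Longrightarrow> \<bar>w (x, t) * pt \<psi> (x, t)\<bar> \<le> C3 * inverse (1 + x\<^sup>2)"
    using mult_test_fun_bound[OF measurable_w(1) C(1) tp(2)] by blast
  obtain C4 where m4: "(\<lambda>z. wt z * \<psi> z) \<in> borel_measurable borel"
    and b4: "\<And>x t. t \<in> {0..T} \<Longrightarrow> \<bar>wt (x, t) * \<psi> (x, t)\<bar> \<le> C4 * inverse (1 + x\<^sup>2)"
    using mult_test_fun_bound[OF measurable_wt C(3) \<psi>] by blast
  have "(LINT z:Dset T|lborel. w z * px \<psi> z) + (LINT z:Dset T|lborel. wx z * \<psi> z)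
      = (LINT t:{0..T}|lborel. (LINT x|lborel. w (x, t) * px \<psi> (x, t) + wx (x, t) * \<psi> (x, t)))"
  proof -
    have "(LINT z:Dset T|lborel. w z * px \<psi> z) + (LINT z:Dset T|lborel. wx z * \<psi> z)
        = (LINT z:Dset T|lborel. w z * px \<psi> z + wx z * \<psi> z)"
      by (intro set_integral_add(2)[symmetric] set_integrable_Dset[OF m1 b1] set_integrable_Dset[OF m2 b2])
    also have "\<dots> = (LINT t:{0..T}|lborel. (LINT x|lborel. w (x, t) * px \<psi> (x, t) + wx (x, t) * \<psi> (x, t)))"
    proof (rule integral_Dset_snd)
      show "(\<lambda>z. w z * px \<psi> z + wx z * \<psi> z) \<in> borel_measurable borel"
        using m1 m2 by simp
      fix x t assume "t \<in> {0..T}"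
      from b1[OF this, of x] b2[OF this, of x]
      show "\<bar>w (x, t) * px \<psi> (x, t) + wx (x, t) * \<psi> (x, t)\<bar> \<le> (C1 + C2) * inverse (1 + x\<^sup>2)"
        unfolding distrib_right by linarith
    qed
    finally show ?thesis .
  qed
  also have "\<dots> = (LINT t:{0..T}|lborel. 0)"
  proof (rule set_lebesgue_integral_cong)
    show "\<forall>t. t \<in> {0..T} \<longrightarrow> (LINT x|lborel. w (x, t) * px \<psi> (x, t) + wx (x, t) * \<psi> (x, t)) = 0"
    proof (intro allI impI)
      fix t assume t: "t \<in> {0..T}"
      let ?F = "\<lambda>x. w (x, t) * \<psi> (x, t)"
      have cF: "continuous_on A ?F" for A
        by (intro continuous_intros continuous_on_compose2[OF continuous_w[of UNIV]]
            continuous_on_compose2[OF smooth2_continuous_on[OF sm, of UNIV]]) auto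
      \<comment> \<open>The same primitive serves both half-lines, so its two values at 0
        cancel.\<close>
      have "(LINT x|lborel. w (x, t) * px \<psi> (x, t) + wx (x, t) * \<psi> (x, t)) = ?F 0 - ?F 0"
      proof (rule integral_two_sided_derivative[OF _ finS cF cF, where R = "max R R'"])
        show "integrable lborel (\<lambda>x. w (x, t) * px \<psi> (x, t) + wx (x, t) * \<psi> (x, t))"
          using integrable_Dset_section[OF m1 b1 t] integrable_Dset_section[OF m2 b2 t] by simp
        show "(?F has_real_derivative w (x, t) * px \<psi> (x, t) + wx (x, t) * \<psi> (x, t)) (at x)"
          if "x \<notin> S" for x
          using DERIV_mult[OF dw_dx[OF that, of t] smooth2_px[OF sm, of t x]] by (simp add: algebra_simps)
        then show "(?F has_real_derivative w (x, t) * px \<psi> (x, t) + wx (x, t) * \<psi> (x, t)) (at x)"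
          if "x \<notin> S" for x using that .
      qed (auto simp: R R')
      then show "(LINT x|lborel. w (x, t) * px \<psi> (x, t) + wx (x, t) * \<psi> (x, t)) = 0" by simp
    qed
  qed simp
  finally show "(LINT z:Dset T|lborel. w z * px \<psi> z) = - (LINT z:Dset T|lborel. wx z * \<psi> z)"
    by simp
  have "(LINT z:Dset T|lborel. w z * pt \<psi> z) = (LINT x|lborel. (LINT t:{0..T}|lborel. w (x, t) * pt \<psi> (x, t)))"
    by (rule integral_Dset_fst[OF m3 b3])
  also have "\<dots> = (LINT x|lborel. - (LINT t:{0..T}|lborel. wt (x, t) * \<psi> (x, t)))"
  proof (rule Bochner_Integration.integral_cong[OF refl])
    fix x
    show "(LINT t:{0..T}|lborel. w (x, t) * pt \<psi> (x, t)) = - (LINT t:{0..T}|lborel. wt (x, t) * \<psi> (x, t))"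
    proof (rule integral_by_parts_periodic[OF dw_dt smooth2_pt[OF sm] continuous_wt])
      show "continuous_on UNIV (\<lambda>t. pt \<psi> (x, t))"
        by (intro continuous_on_compose2[OF smooth2_continuous_on[OF test_fun_smooth2[OF tp(2)], of UNIV]]
            continuous_intros) auto
    qed (use T_pos periodic_w[of x 0] test_fun_periodic[OF \<psi>, of x 0] in auto)
  qed
  also have "\<dots> = - (LINT z:Dset T|lborel. wt z * \<psi> z)"
    using integral_Dset_fst[OF m4 b4] by simp
  finally show "(LINT z:Dset T|lborel. w z * pt \<psi> z) = - (LINT z:Dset T|lborel. wt z * \<psi> z)" .
qed

lemma H1D_w: "H1D T w"
  unfolding H1D_def tperiodic_def using L2D_fields weak_derivs_w periodic_w by blast

text \<open>The layer equation s^2 w_tt = w_xx, tested in t only. For smooth profiles it would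
  follow by differentiating under the integral and integrating by parts in t; here each travelling
  part is translated onto the test function instead.\<close>

lemma flux_pairing_derivative:
  assumes \<psi>: "test_fun T \<psi>" and x: "x \<notin> S"
  shows "((\<lambda>y. integral {0..T} (\<lambda>t. flux (y, t) * \<psi> (y, t))) has_real_derivative
    sgn x * integral {0..T} (\<lambda>t. - (s x)\<^sup>2 * wt (x, t) * pt \<psi> (x, t) + wx (x, t) * px \<psi> (x, t))) (at x)"
proof -
  note tp = test_fun_partials[OF \<psi>]
  note cts = smooth2_continuous_on[OF test_fun_smooth2[OF \<psi>], of UNIV]
    smooth2_continuous_on[OF test_fun_smooth2[OF tp(1)], of UNIV]
    smooth2_continuous_on[OF test_fun_smooth2[OF tp(2)], of UNIV]
  have x0: "x \<noteq> 0" using x zero_S by auto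
  define k where "k = sgn x * s x"
  obtain d where d: "d > 0" "\<And>y. \<bar>y - x\<bar> < d \<Longrightarrow> \<alpha> y = \<alpha> x \<and> s y = s x \<and> \<xi> y = \<xi> x + k * (y - x)"
    using locally_affine[OF x] unfolding k_def by blast
  \<comment> \<open>\<open>e\<close> = 1 and \<open>e\<close> = -1 select the two travelling parts,
    with the phase continued affinely from x.\<close>
  define J where "J e y = integral {0..T} (\<lambda>t. V (t - (e * \<xi> x + e * k * (y - x))) * \<psi> (y, t))" for e y
  define J' where "J' e = integral {0..T} (\<lambda>t. V (t - e * \<xi> x) * (px \<psi> (x, t) + e * k * pt \<psi> (x, t)))" for e
  have DJ: "(J e has_real_derivative J' e) (at x)" for e
    unfolding J_def[abs_def] J'_def
    using travelling_wave_derivative[OF contV perV _ \<psi>, of "e * \<xi> x" "e * k" x] T_pos by simp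
  have D: "((\<lambda>y. \<alpha> x * s x * (- J 1 y + \<sigma> * J (-1) y)) has_real_derivative
      \<alpha> x * s x * (- J' 1 + \<sigma> * J' (-1))) (at x)"
    by (intro DERIV_cmult DERIV_add DERIV_minus DJ)
  have intJ: "(\<lambda>t. V (t - e * c) * f t) integrable_on {0..T}" if "continuous_on UNIV f" for e c f
    by (intro integrable_continuous_interval continuous_intros continuous_on_compose2[OF contV]
        continuous_on_subset[OF that]) auto
  have "\<alpha> x * s x * (- J' 1 + \<sigma> * J' (-1)) = integral {0..T} (\<lambda>t. \<alpha> x * s x *
     (- (V (t - 1 * \<xi> x) * (px \<psi> (x, t) + 1 * k * pt \<psi> (x, t)))
      + \<sigma> * (V (t - (-1) * \<xi> x) * (px \<psi> (x, t) + (-1) * k * pt \<psi> (x, t)))))"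
  proof -
    have c: "continuous_on UNIV (\<lambda>t. px \<psi> (x, t) + e * k * pt \<psi> (x, t))" for e
      by (intro continuous_intros continuous_on_compose2[OF cts(2)] continuous_on_compose2[OF cts(3)]) auto
    have "((\<lambda>t. V (t - e * \<xi> x) * (px \<psi> (x, t) + e * k * pt \<psi> (x, t))) has_integral J' e) {0..T}" for e
      unfolding J'_def by (intro integrable_integral intJ c)
    then have "((\<lambda>t. \<alpha> x * s x *
     (- (V (t - 1 * \<xi> x) * (px \<psi> (x, t) + 1 * k * pt \<psi> (x, t)))
      + \<sigma> * (V (t - (-1) * \<xi> x) * (px \<psi> (x, t) + (-1) * k * pt \<psi> (x, t))))) has_integral
       \<alpha> x * s x * (- J' 1 + \<sigma> * J' (-1))) {0..T}"
      by (intro has_integral_mult_right has_integral_add has_integral_neg)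
    then show ?thesis by (rule integral_unique[symmetric])
  qed
  also have "\<dots> = integral {0..T} (\<lambda>t. sgn x *
      (- (s x)\<^sup>2 * wt (x, t) * pt \<psi> (x, t) + wx (x, t) * px \<psi> (x, t)))"
  proof (rule arg_cong[where f = "integral {0..T}"], rule ext)
    fix t
    have sgn_wx: "sgn x * wx (x, t) = flux (x, t)" using x0 by (simp add: wx_def sgn_if)
    have "sgn x * (- (s x)\<^sup>2 * wt (x, t) * pt \<psi> (x, t) + wx (x, t) * px \<psi> (x, t))
      = - (sgn x * (s x)\<^sup>2 * wt (x, t) * pt \<psi> (x, t)) + flux (x, t) * px \<psi> (x, t)"
      unfolding sgn_wx[symmetric] by (simp add: algebra_simps)
    then show "\<alpha> x * s x *
     (- (V (t - 1 * \<xi> x) * (px \<psi> (x, t) + 1 * k * pt \<psi> (x, t)))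
      + \<sigma> * (V (t - (-1) * \<xi> x) * (px \<psi> (x, t) + (-1) * k * pt \<psi> (x, t))))
      = sgn x * (- (s x)\<^sup>2 * wt (x, t) * pt \<psi> (x, t) + wx (x, t) * px \<psi> (x, t))"
      by (simp only:) (simp add: k_def wt_def flux_def algebra_simps power2_eq_square)
  qed
  also have "\<dots> = sgn x * integral {0..T} (\<lambda>t. - (s x)\<^sup>2 * wt (x, t) * pt \<psi> (x, t) + wx (x, t) * px \<psi> (x, t))"
    by (rule integral_mult_right)
  finally have eq: "\<alpha> x * s x * (- J' 1 + \<sigma> * J' (-1)) = \<dots>" .
  have near: "\<alpha> x * s x * (- J 1 y + \<sigma> * J (-1) y) = integral {0..T} (\<lambda>t. flux (y, t) * \<psi> (y, t))"
    if y: "y \<in> ball x d" for y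
  proof -
    have "\<bar>y - x\<bar> < d" using y by (simp add: dist_real_def abs_minus_commute)
    from d(2)[OF this] have loc: "\<alpha> y = \<alpha> x" "s y = s x" "\<xi> y = \<xi> x + k * (y - x)"
      by blast+
    have J: "J e y = integral {0..T} (\<lambda>t. V (t - e * \<xi> y) * \<psi> (y, t))" for e
      unfolding J_def loc by (simp add: algebra_simps)
    have "continuous_on UNIV (\<lambda>t. \<psi> (y, t))"
      by (intro continuous_intros continuous_on_compose2[OF cts(1)]) auto
    then have "((\<lambda>t. V (t - e * \<xi> y) * \<psi> (y, t)) has_integral J e y) {0..T}" for e
      unfolding J by (intro integrable_integral intJ)
    then have "((\<lambda>t. \<alpha> x * s x * (- (V (t - 1 * \<xi> y) * \<psi> (y, t)) + \<sigma> * (V (t - (-1) * \<xi> y) * \<psi> (y, t))))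
       has_integral \<alpha> x * s x * (- J 1 y + \<sigma> * J (-1) y)) {0..T}"
      by (intro has_integral_mult_right has_integral_add has_integral_neg)
    then have "\<alpha> x * s x * (- J 1 y + \<sigma> * J (-1) y) = integral {0..T}
       (\<lambda>t. \<alpha> x * s x * (- (V (t - 1 * \<xi> y) * \<psi> (y, t)) + \<sigma> * (V (t - (-1) * \<xi> y) * \<psi> (y, t))))"
      by (rule integral_unique[symmetric])
    also have "\<dots> = integral {0..T} (\<lambda>t. flux (y, t) * \<psi> (y, t))"
      by (rule arg_cong[where f = "integral {0..T}"], rule ext)
         (simp add: flux_def loc(1,2) algebra_simps)
    finally show ?thesis .
  qed
  show ?thesis
    by (rule has_field_derivative_transform_within_open[OF D[unfolded eq], of "ball x d"])
       (simp_all only: near d(1) open_ball centre_in_ball)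
qed

text \<open>\<open>kirchhoff\<close> is the jump condition at the delta: the jump of w_x, which is
  twice the flux, equals the time derivative of \<gamma> w_t^3. The equation in the layers leaves
  only a boundary integral of the flux at 0, and integrating \<open>kirchhoff\<close> by parts in
  time turns it into the nonlinear term.\<close>

theorem weak_solution_w:
  assumes g: "countable N" "\<And>x. x \<notin> N \<Longrightarrow> g x = (s x)\<^sup>2"
    and kirchhoff: "\<And>t. ((\<lambda>t. \<gamma> * wt (0, t) ^ 3) has_real_derivative 2 * flux (0, t)) (at t)"
  shows "weak_solution T g \<gamma> w"
proof -
  let ?v = "\<lambda>t. wt (0, t)"
  have "weak_deriv_torus T (\<lambda>t. w (0, t)) ?v"
    unfolding weak_deriv_torus_def test_fun_torus_def
  proof (intro allI impI, elim conjE)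
    fix \<phi> assume \<phi>: "smooth1 \<phi>" "\<forall>t. \<phi> (t + T) = \<phi> t"
    show "(LINT t:{0..T}|lborel. w (0, t) * deriv \<phi> t) = - (LINT t:{0..T}|lborel. wt (0, t) * \<phi> t)"
      by (rule integral_by_parts_periodic[OF dw_dt smooth1_derivative(1)[OF \<phi>(1)] continuous_wt
            smooth1_derivative(2)[OF \<phi>(1)]])
         (use T_pos periodic_w[of 0 0] \<phi>(2)[rule_format, of 0] in auto)
  qed
  moreover have "(LINT z:Dset T|lborel. - g (fst z) * wt z * pt \<psi> z + wx z * px \<psi> z)
          - \<gamma> * (LINT t:{0..T}|lborel. (?v t) ^ 3 * pt \<psi> (0, t)) = 0" if \<psi>: "test_fun T \<psi>" for \<psi>
  proof -
    note tp = test_fun_partials[OF \<psi>] and sm = test_fun_smooth2[OF \<psi>]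
    note cts = smooth2_continuous_on[OF sm, of UNIV]
      smooth2_continuous_on[OF test_fun_smooth2[OF tp(1)], of UNIV]
      smooth2_continuous_on[OF test_fun_smooth2[OF tp(2)], of UNIV]
    have ct: "continuous_on A (\<lambda>t. \<psi> (x, t))" "continuous_on A (\<lambda>t. px \<psi> (x, t))" "continuous_on A (\<lambda>t. pt \<psi> (x, t))" for A x
      by (intro continuous_on_compose2[OF cts(1)] continuous_on_compose2[OF cts(2)] continuous_on_compose2[OF cts(3)] continuous_intros; simp)+
    define f where "f z = - (s (fst z))\<^sup>2 * wt z * pt \<psi> z + wx z * px \<psi> z" for z
    define I where "I x = integral {0..T} (\<lambda>t. flux (x, t) * \<psi> (x, t))" for x
    obtain R where R: "\<And>x t. R < \<bar>x\<bar> \<Longrightarrow> \<psi> (x, t) = 0"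
      using \<psi> unfolding test_fun_def by blast
    obtain R1 where R1: "\<And>x t. R1 < \<bar>x\<bar> \<Longrightarrow> px \<psi> (x, t) = 0"
      using tp(1) unfolding test_fun_def by blast
    obtain R2 where R2: "\<And>x t. R2 < \<bar>x\<bar> \<Longrightarrow> pt \<psi> (x, t) = 0"
      using tp(2) unfolding test_fun_def by blast
    obtain C where C: "\<And>z. \<bar>w z\<bar> \<le> C" "\<And>z. \<bar>wx z\<bar> \<le> C" "\<And>z. \<bar>wt z\<bar> \<le> C"
      using bounded_fields by blast
    have ms: "(\<lambda>z. - (s (fst z))\<^sup>2 * wt z) \<in> borel_measurable borel"
      using measurable_fst_comp[OF meas(2)] measurable_wt by simp
    have bs: "\<bar>- (s (fst z))\<^sup>2 * wt z\<bar> \<le> B\<^sup>2 * C" for z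
    proof -
      have "(s (fst z))\<^sup>2 \<le> B\<^sup>2" using power_mono[OF bds[of "fst z"], of 2] by simp
      then show ?thesis using C(3)[of z] by (simp add: abs_mult mult_mono)
    qed
    obtain C1 where m1: "(\<lambda>z. - (s (fst z))\<^sup>2 * wt z * pt \<psi> z) \<in> borel_measurable borel"
      and b1: "\<And>x t. t \<in> {0..T} \<Longrightarrow> \<bar>- (s (fst (x, t)))\<^sup>2 * wt (x, t) * pt \<psi> (x, t)\<bar> \<le> C1 * inverse (1 + x\<^sup>2)"
      using mult_test_fun_bound[OF ms bs tp(2)] by blast
    obtain C2 where m2: "(\<lambda>z. wx z * px \<psi> z) \<in> borel_measurable borel"
      and b2: "\<And>x t. t \<in> {0..T} \<Longrightarrow> \<bar>wx (x, t) * px \<psi> (x, t)\<bar> \<le> C2 * inverse (1 + x\<^sup>2)"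
      using mult_test_fun_bound[OF measurable_wx C(2) tp(1)] by blast
    have mf: "f \<in> borel_measurable borel" unfolding f_def using m1 m2 by simp
    have bf: "\<bar>f (x, t)\<bar> \<le> (C1 + C2) * inverse (1 + x\<^sup>2)" if "t \<in> {0..T}" for x t
      using b1[OF that, of x] b2[OF that, of x] unfolding f_def distrib_right by linarith
    \<comment> \<open>Measurability of \<open>g\<close> is inherited from \<open>s\<close>^2, from
      which it differs only on a countable set.\<close>
    have mg: "g \<in> borel_measurable borel"
    proof (rule measurable_discrete_difference[where f = "\<lambda>x. (s x)\<^sup>2" and X = N])
      show "(\<lambda>x. (s x)\<^sup>2) \<in> borel_measurable borel" using meas(2) by simp
    qed (use g in auto)
    have "(LINT z:Dset T|lborel. - g (fst z) * wt z * pt \<psi> z + wx z * px \<psi> z) = (LINT z:Dset T|lborel. f z)"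
    proof (rule set_lebesgue_integral_cong_AE)
      show "Dset T \<in> sets lborel" by (auto simp: Dset_def intro!: borel_closed closed_Times)
      show "(\<lambda>z. - g (fst z) * wt z * pt \<psi> z + wx z * px \<psi> z) \<in> borel_measurable lborel"
        using measurable_fst_comp[OF mg] measurable_wt measurable_wx test_fun_measurable[OF tp(1)]
          test_fun_measurable[OF tp(2)] by simp
      show "f \<in> borel_measurable lborel" using mf by simp
      show "AE z\<in>Dset T in lborel. - g (fst z) * wt z * pt \<psi> z + wx z * px \<psi> z = f z"
        using AE_fst_notin_countable[OF g(1)] by eventually_elim (simp add: f_def g(2))
    qed
    also have "\<dots> = (LINT x|lborel. (LINT t:{0..T}|lborel. f (x, t)))"
      by (rule integral_Dset_fst[OF mf bf])
    \<comment> \<open>On the left half-line the flux is minus the x-derivative, so \<open>I\<close>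
      is a primitive on the right and \<open>- I\<close> on the left. The boundary values at 0 add
      up instead of cancelling.\<close>
    also have "\<dots> = (- I 0) - I 0"
    proof (rule integral_two_sided_derivative[OF integrable_Dset_fst[OF mf bf] finS, where R = "max R (max R1 R2)" and G = "\<lambda>x. - I x"])
      have "continuous_on UNIV (\<lambda>x. integral (cbox 0 T) (\<lambda>t. flux (x, t) * \<psi> (x, t)))"
        by (rule integral_continuous_on_param)
           (auto simp: split_beta intro!: continuous_intros continuous_flux smooth2_continuous_on[OF sm])
      then have cI: "continuous_on A I" for A
        unfolding I_def using continuous_on_subset by fastforce
      show "continuous_on {0..} I" by (rule cI)
      show "continuous_on {..0} (\<lambda>x. - I x)" by (intro continuous_intros cI)
      have K: "(LINT t:{0..T}|lborel. f (x, t)) = integral {0..T} (\<lambda>t. - (s x)\<^sup>2 * wt (x, t) * pt \<psi> (x, t) + wx (x, t) * px \<psi> (x, t))" for x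
        unfolding f_def fst_conv wx_def
        by (intro set_lborel_integral_continuous continuous_intros continuous_wt continuous_flux_section ct)
      show "(I has_real_derivative (LINT t:{0..T}|lborel. f (x, t))) (at x)" if "x > 0" "x \<notin> S" for x
        using flux_pairing_derivative[OF \<psi> that(2)] that(1) unfolding K I_def by simp
      show "((\<lambda>x. - I x) has_real_derivative (LINT t:{0..T}|lborel. f (x, t))) (at x)" if "x < 0" "x \<notin> S" for x
        using DERIV_minus[OF flux_pairing_derivative[OF \<psi> that(2)]] that(1) unfolding K I_def by simp
    qed (auto simp: R R1 R2 I_def f_def)
    finally have 1: "(LINT z:Dset T|lborel. - g (fst z) * wt z * pt \<psi> z + wx z * px \<psi> z) = - 2 * I 0"
      by simp
    have "(LINT t:{0..T}|lborel. (\<gamma> * ?v t ^ 3) * pt \<psi> (0, t))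
       = - (LINT t:{0..T}|lborel. (2 * flux (0, t)) * \<psi> (0, t))"
      by (rule integral_by_parts_periodic[OF kirchhoff smooth2_pt[OF sm]])
         (use T_pos periodic_wt[of 0 0] test_fun_periodic[OF \<psi>, of 0 0] in
           \<open>auto intro!: continuous_intros continuous_flux_section ct\<close>)
    also have "(LINT t:{0..T}|lborel. (2 * flux (0, t)) * \<psi> (0, t)) = 2 * (LINT t:{0..T}|lborel. flux (0, t) * \<psi> (0, t))"
      by (simp add: mult.assoc)
    also have "(LINT t:{0..T}|lborel. flux (0, t) * \<psi> (0, t)) = I 0"
      unfolding I_def by (intro set_lborel_integral_continuous continuous_intros continuous_flux_section ct)
    also have "(LINT t:{0..T}|lborel. (\<gamma> * ?v t ^ 3) * pt \<psi> (0, t)) = \<gamma> * (LINT t:{0..T}|lborel. ?v t ^ 3 * pt \<psi> (0, t))"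
      by (simp add: mult.assoc)
    finally show ?thesis using 1 by simp
  qed
  ultimately show ?thesis
    unfolding weak_solution_def
    using H1D_w L2D_fields weak_derivs_w continuous_is_trace0[OF continuous_w T_pos]
      continuous_Lp_torus[OF continuous_wt] by blast
qed

end

section \<open>Antiperiodic shifts and the scaling of the oscillator\<close>

lemma periodic_int_shift:
  fixes g :: "real \<Rightarrow> real" and n :: int
  assumes "\<And>x. g (x + P) = g x"
  shows "g (x + of_int n * P) = g x"
proof -
  have nat: "g (x + of_nat k * P) = g x" for k x
  proof (induction k)
    case (Suc k)
    have "g (x + of_nat (Suc k) * P) = g ((x + of_nat k * P) + P)"
      by (rule arg_cong[of _ _ g]) (simp add: algebra_simps)
    then show ?case by (simp only: assms Suc)
  qed simp
  show ?thesis
  proof (cases "n \<ge> 0")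
    case True
    then show ?thesis using nat[of x "nat n"] by simp
  next
    case False
    then show ?thesis using nat[of "x + of_int n * P" "nat (- n)"] by simp
  qed
qed

text \<open>Reduces each phase relation to a residue modulo 4 of a multiple of
  \<open>Q\<close>.\<close>

lemma antiperiodic_shift:
  fixes f :: "real \<Rightarrow> real" and n :: int
  assumes anti: "\<And>t. f (t + 2 * Q) = - f t"
  shows "f (t + 4 * of_int n * Q) = f t" "f (t + (4 * of_int n + 2) * Q) = - f t"
proof -
  have per: "f (t + 4 * Q) = f t" for t
  proof -
    have "f (t + 4 * Q) = f (t + 2 * Q + 2 * Q)" by (rule arg_cong[of _ _ f]) simp
    then show ?thesis by (simp only: anti minus_minus)
  qed
  have int: "f (t + 4 * of_int n * Q) = f t" for t
  proof -
    have "f (t + 4 * of_int n * Q) = f (t + of_int n * (4 * Q))" by (rule arg_cong[of _ _ f]) simp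
    then show ?thesis by (simp only: periodic_int_shift[of f "4 * Q", OF per])
  qed
  then show "f (t + 4 * of_int n * Q) = f t" .
  have "f (t + (4 * of_int n + 2) * Q) = f ((t + 4 * of_int n * Q) + 2 * Q)"
    by (rule arg_cong[of _ _ f]) (simp add: algebra_simps)
  then show "f (t + (4 * of_int n + 2) * Q) = - f t" by (simp only: anti int)
qed

text \<open>\<open>c\<close> is fixed before \<open>Q\<close>, so the maximum of \<open>u\<close> is
  a strictly increasing function of \<open>Q\<close>; this is what later separates the
  solutions.\<close>

lemma scaled_oscillator:
  fixes \<kappa> :: real
  assumes \<kappa>: "\<kappa> > 0"
  obtains c where "c > 0"
    "\<And>Q. Q > 0 \<Longrightarrow> \<exists>u v B. continuous_on UNIV v \<and>
      (\<forall>t. ((\<lambda>t. v t ^ 3) has_real_derivative \<kappa> * v (t + Q)) (at t)) \<and>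
      (\<forall>t. (u has_real_derivative v t) (at t)) \<and>
      (\<forall>t. v (t + 2 * Q) = - v t) \<and> (\<forall>t. u (t + 2 * Q) = - u t) \<and> (\<forall>t. \<bar>v t\<bar> \<le> B) \<and>
      (\<forall>t. \<bar>u t\<bar> \<le> c * sqrt Q ^ 3) \<and> u (2 * Q) = c * sqrt Q ^ 3"
proof -
  obtain Q0 :: real and \<phi> where Q0: "Q0 > 0" and cont: "continuous_on UNIV \<phi>"
    and d: "\<And>t. ((\<lambda>t. \<phi> t ^ 3) has_real_derivative \<phi> (t + Q0)) (at t)"
    and anti: "\<And>t. \<phi> (t + 2 * Q0) = - \<phi> t" and bd: "\<And>t. \<bar>\<phi> t\<bar> \<le> 1" and top: "\<phi> Q0 = 1"
    by (rule oscillator_exists) (rule that, assumption+)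
  define c where "c = sqrt (\<kappa> / Q0) ^ 3 / \<kappa>"
  have c: "c > 0" using \<kappa> Q0 by (simp add: c_def)
  show ?thesis
  proof (rule that[OF c])
    fix Q :: real assume Q: "Q > 0"
    define \<mu> where "\<mu> = Q / Q0"
    \<comment> \<open>Stretching time by \<mu> and the amplitude by E turns the coefficient into E^2
      / \<mu>, so E^2 must be \<kappa> \<mu>.\<close>
    define E where "E = sqrt (\<kappa> / Q0) * sqrt Q"
    define v where "v t = E * \<phi> (t / \<mu>)" for t
    \<comment> \<open>The equation supplies an antiderivative without integration: the cube at time
      t + Q has derivative \<kappa> v(t + 2Q) = - \<kappa> v(t).\<close>
    define u where "u t = - (v (t + Q) ^ 3) / \<kappa>" for t
    have \<mu>: "\<mu> > 0" "Q / \<mu> = Q0" using Q Q0 by (auto simp: \<mu>_def)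
    have E: "E > 0" "E ^ 2 = \<kappa> * \<mu>" "E ^ 3 / \<kappa> = c * sqrt Q ^ 3"
      using Q Q0 \<kappa> by (auto simp: E_def \<mu>_def c_def power_mult_distrib)
    have cv: "continuous_on UNIV v"
      unfolding v_def by (intro continuous_intros continuous_on_compose2[OF cont]) (use \<mu> in auto)
    have shift: "(t + y * Q) / \<mu> = t / \<mu> + y * Q0" for t y
      using \<mu> Q0 Q by (simp add: \<mu>_def field_simps)
    have anti_v: "v (t + 2 * Q) = - v t" for t
      by (simp only: v_def shift anti mult_minus_right)
    have dv: "((\<lambda>t. v t ^ 3) has_real_derivative \<kappa> * v (t + Q)) (at t)" for t
    proof -
      have D: "((\<lambda>t. \<phi> (t / \<mu>) ^ 3) has_real_derivative \<phi> (t / \<mu> + Q0) * (1 / \<mu>)) (at t)"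
        by (rule DERIV_chain2[where f = "\<lambda>t. \<phi> t ^ 3" and g = "\<lambda>t. t / \<mu>"], rule d)
           (use \<mu> in \<open>auto intro!: derivative_eq_intros\<close>)
      have "E ^ 3 * (\<phi> (t / \<mu> + Q0) * (1 / \<mu>)) = \<kappa> * v (t + Q)"
      proof -
        have "E ^ 3 = \<kappa> * \<mu> * E" using E(2) by (simp add: power3_eq_cube power2_eq_square)
        then show ?thesis using \<mu> shift[of t 1] by (simp add: v_def)
      qed
      then show ?thesis
        using DERIV_cmult[OF D, of "E ^ 3"] by (simp add: v_def power_mult_distrib)
    qed
    have du: "(u has_real_derivative v t) (at t)" for t
    proof -
      have "((\<lambda>t. v (t + Q) ^ 3) has_real_derivative \<kappa> * v (t + Q + Q)) (at t)"
        by (rule DERIV_shift[THEN iffD1, OF dv])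
      moreover have "v (t + Q + Q) = - v t" using anti_v[of t] by (simp add: add.assoc)
      ultimately have "((\<lambda>t. v (t + Q) ^ 3) has_real_derivative - (\<kappa> * v t)) (at t)" by simp
      from DERIV_cdivide[OF DERIV_minus[OF this], of \<kappa>] show ?thesis
        using \<kappa> by (simp add: u_def[abs_def])
    qed
    have bd_v: "\<bar>v t\<bar> \<le> E" for t
      using mult_left_mono[OF bd[of "t / \<mu>"], of E] E(1) by (simp add: v_def abs_mult)
    have bd_u: "\<bar>u t\<bar> \<le> c * sqrt Q ^ 3" for t
    proof -
      have "\<bar>v (t + Q)\<bar> ^ 3 \<le> E ^ 3" by (intro power_mono bd_v) simp
      then have "\<bar>u t\<bar> \<le> E ^ 3 / \<kappa>" using \<kappa> by (simp add: u_def power_abs divide_right_mono)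
      then show ?thesis using E(3) by simp
    qed
    have anti_u: "u (t + 2 * Q) = - u t" for t
    proof -
      have "v (t + 2 * Q + Q) = - v (t + Q)" using anti_v[of "t + Q"] by (simp add: algebra_simps)
      then show ?thesis by (simp add: u_def)
    qed
    \<comment> \<open>The oscillator peaks at Q0, so v(Q) = E, and half a period later v is at its
      minimum; \<open>u\<close> is therefore maximal at 2Q.\<close>
    have "v (2 * Q + Q) = - E"
      using anti_v[of Q] \<mu>(2) top by (simp add: v_def add.commute)
    then have "u (2 * Q) = c * sqrt Q ^ 3" using E(3) by (simp add: u_def)
    then show "\<exists>u v B. continuous_on UNIV v \<and>
      (\<forall>t. ((\<lambda>t. v t ^ 3) has_real_derivative \<kappa> * v (t + Q)) (at t)) \<and>
      (\<forall>t. (u has_real_derivative v t) (at t)) \<and>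
      (\<forall>t. v (t + 2 * Q) = - v t) \<and> (\<forall>t. u (t + 2 * Q) = - u t) \<and> (\<forall>t. \<bar>v t\<bar> \<le> B) \<and>
      (\<forall>t. \<bar>u t\<bar> \<le> c * sqrt Q ^ 3) \<and> u (2 * Q) = c * sqrt Q ^ 3"
      by (intro exI[of _ u] exI[of _ v] exI[of _ E] conjI allI cv dv du anti_v anti_u bd_v bd_u)
  qed
qed

section \<open>The two-step periodic medium\<close>

text \<open>Where the amplitude jumps the profile vanishes for all times, and a bounded factor times
  one tending to 0 tends to 0. Elsewhere the amplitude is locally constant.\<close>

lemma isCont_amplitude_times_profile:
  fixes f \<xi> :: "real \<Rightarrow> real" and W :: "real \<times> real \<Rightarrow> real"
  assumes \<xi>: "isCont \<xi> x" and f: "\<And>y. \<bar>f y\<bar> \<le> C" and W: "continuous_on UNIV W"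
    and cases: "(\<forall>\<^sub>F y in nhds x. f y = f x) \<or> (\<forall>t. W (\<xi> x, t) = 0)"
  shows "isCont (\<lambda>z. f (fst z) * W (\<xi> (fst z), snd z)) (x, t)"
proof -
  have cfst: "isCont (\<lambda>z::real \<times> real. fst z) (x, t)" "isCont (\<lambda>z::real \<times> real. snd z) (x, t)"
    by (intro continuous_intros)+
  have "isCont (\<lambda>z. \<xi> (fst z)) (x, t)"
    using isCont_o2[OF cfst(1), of \<xi>] \<xi> by simp
  then have p: "isCont (\<lambda>z. (\<xi> (fst z), snd z)) (x, t)"
    using cfst(2) by (rule continuous_Pair)
  have cW: "isCont (\<lambda>z. W (\<xi> (fst z), snd z)) (x, t)"
    by (rule isCont_o2[OF p]) (use W in \<open>simp add: continuous_on_eq_continuous_at\<close>)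
  from cases show ?thesis
  proof
    assume ev: "\<forall>\<^sub>F y in nhds x. f y = f x"
    have "((\<lambda>z. fst z) \<longlongrightarrow> fst (x, t)) (nhds (x, t))"
      by (rule tendsto_fst) (rule filterlim_ident)
    then have "filterlim (\<lambda>z. fst z) (nhds x) (nhds (x, t))" by (simp only: fst_conv)
    with ev have "\<forall>\<^sub>F z in nhds (x, t). f (fst z) = f x"
      by (rule eventually_compose_filterlim)
    then have "\<forall>\<^sub>F z in nhds (x, t). f (fst z) * W (\<xi> (fst z), snd z) = f x * W (\<xi> (fst z), snd z)"
      by eventually_elim simp
    then show ?thesis
      using isCont_cong[of "\<lambda>z. f (fst z) * W (\<xi> (fst z), snd z)" "\<lambda>z. f x * W (\<xi> (fst z), snd z)"]
        continuous_mult_left[OF cW, of "f x"] by simp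
  next
    assume zero: "\<forall>t. W (\<xi> x, t) = 0"
    have "((\<lambda>z. W (\<xi> (fst z), snd z)) \<longlongrightarrow> 0) (at (x, t))"
      using cW zero by (simp add: isCont_def)
    then have "((\<lambda>z. f (fst z) * W (\<xi> (fst z), snd z)) \<longlongrightarrow> 0) (at (x, t))"
    proof (rule tendsto_0_le[where K = C])
      have "\<bar>f y * k\<bar> \<le> \<bar>k\<bar> * C" for y k
        using mult_left_mono[OF f[of y], of "\<bar>k\<bar>"] by (simp add: abs_mult mult.commute)
      then show "\<forall>\<^sub>F z in at (x, t). norm (f (fst z) * W (\<xi> (fst z), snd z)) \<le> norm (W (\<xi> (fst z), snd z)) * C"
        by simp
    qed
    then show ?thesis using zero by (simp add: isCont_def)
  qed
qed

text \<open>Once per period, at an interface where the wave vanishes, the amplitude drops by the factor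
  \<open>\<delta> < 1\<close>, which makes up for the jump of the speed in the flux; at the other interface the flux
  vanishes. For \<open>\<sigma> = 1\<close> the drop happens on entering an inner layer, for \<open>\<sigma> = -1\<close> on leaving one.
  Each cell starts with its inner layer, so its offsets run over \<open>[-A, 2\<pi> - A)\<close>; the functions
  are meaningful for \<open>x > -A\<close> only.\<close>

locale step_medium =
  fixes sa sb A \<sigma> :: real
  assumes sa: "sa > 0" and sb: "sb > 0" and A: "0 < A" "A < pi"
    and sigma: "\<sigma> = 1 \<and> sb < sa \<or> \<sigma> = -1 \<and> sa < sb"
begin

definition \<delta> :: real where "\<delta> = (if \<sigma> = 1 then sb / sa else sa / sb)"
definition e :: nat where "e = (if \<sigma> = 1 then 0 else 1)"
definition cell :: "real \<Rightarrow> int" where "cell x = \<lfloor>(x + A) / (2 * pi)\<rfloor>"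
definition off :: "real \<Rightarrow> real" where "off x = x - 2 * pi * of_int (cell x)"
definition sp :: "real \<Rightarrow> real" where "sp x = (if off x < A then sa else sb)"
definition amp :: "real \<Rightarrow> real" where
  "amp x = \<delta> ^ (nat (cell x) + (if off x < A then 0 else e))"
definition period_time :: real where "period_time = 2 * sa * A + 2 * sb * (pi - A)"
text \<open>Signed travel time from the right end x = A of the central layer. With this origin the
  phase is n \<open>period_time\<close> at right ends of inner layers and n
  \<open>period_time\<close> - 2 \<open>sa\<close> A at left ends.\<close>

definition travel :: "real \<Rightarrow> real" where
  "travel x = of_int (cell x) * period_time + sp x * (off x - A)"

lemma delta: "0 < \<delta>" "\<delta> < 1"
  using sigma sa sb by (auto simp: \<delta>_def)

lemma jump: "\<sigma> = 1 \<Longrightarrow> e = 0" "\<sigma> = 1 \<Longrightarrow> \<delta> * sa = sb" "\<sigma> = - 1 \<Longrightarrow> e = 1" "\<sigma> = - 1 \<Longrightarrow> \<delta> * sb = sa"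
  using sa sb unfolding e_def \<delta>_def by simp_all

lemma off_bounds: "- A \<le> off x" "off x < 2 * pi - A"
proof -
  have "of_int (cell x) \<le> (x + A) / (2 * pi)" "(x + A) / (2 * pi) < of_int (cell x) + 1"
    unfolding cell_def by linarith+
  then have "of_int (cell x) * (2 * pi) \<le> x + A" "x + A < (of_int (cell x) + 1) * (2 * pi)"
    by (simp_all add: pos_le_divide_eq pos_divide_less_eq)
  then show "- A \<le> off x" "off x < 2 * pi - A"
    unfolding off_def by (simp_all add: algebra_simps)
qed

lemma cell_eqI:
  assumes "- A \<le> x - 2 * pi * of_int n" "x - 2 * pi * of_int n < 2 * pi - A"
  shows "cell x = n"
proof -
  have "of_int n \<le> (x + A) / (2 * pi)" "(x + A) / (2 * pi) < of_int n + 1"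
    using assms by (simp_all add: pos_le_divide_eq pos_divide_less_eq algebra_simps)
  then show ?thesis unfolding cell_def by (rule floor_unique)
qed

lemma cell_nonneg: "x > - A \<Longrightarrow> cell x \<ge> 0"
  unfolding cell_def by simp

lemma same_cell:
  assumes "- A \<le> off x + (y - x)" "off x + (y - x) < 2 * pi - A"
  shows "cell y = cell x" "off y = off x + (y - x)"
proof -
  show *: "cell y = cell x"
    by (rule cell_eqI) (use assms in \<open>simp_all add: off_def\<close>)
  then show "off y = off x + (y - x)" by (simp add: off_def)
qed

text \<open>The slope of \<open>travel\<close> is taken at \<open>y\<close>, not at
  \<open>x\<close>, so the formula is exact at a kink too. At each interface \<open>\<sigma>\<close>
  decides whether \<open>amp\<close> or \<open>amp\<close> times \<open>sp\<close> passes unchanged;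
  the former keeps the wave continuous and the latter the flux.\<close>

lemma local_structure:
  assumes x: "x > - A"
  shows "\<exists>d>0. \<forall>y. \<bar>y - x\<bar> < d \<longrightarrow> travel y = travel x + sp y * (y - x) \<and>
    (off x \<noteq> A \<and> off x \<noteq> - A \<longrightarrow> sp y = sp x \<and> amp y = amp x) \<and>
    (off x = A \<longrightarrow> (\<sigma> = 1 \<longrightarrow> amp y = amp x) \<and> (\<sigma> = -1 \<longrightarrow> amp y * sp y = amp x * sp x)) \<and>
    (off x = - A \<longrightarrow> (\<sigma> = -1 \<longrightarrow> amp y = amp x) \<and> (\<sigma> = 1 \<longrightarrow> amp y * sp y = amp x * sp x))"
    (is "\<exists>d>0. \<forall>y. \<bar>y - x\<bar> < d \<longrightarrow> ?P y")
proof -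
  consider "- A < off x" "off x < A" | "off x > A" | "off x = A" | "off x = - A"
    using off_bounds[of x] by linarith
  then show ?thesis
  proof cases
    case 1
    define d where "d = min (off x + A) (A - off x)"
    have *: "cell y = cell x" "off y = off x + (y - x)" "off y < A" if "\<bar>y - x\<bar> < d" for y
      using same_cell[of x y] that A by (auto simp: d_def)
    have "?P y" if y: "\<bar>y - x\<bar> < d" for y
    proof -
      have "sp y = sp x" "amp y = amp x"
        using *(1,3)[OF y] 1 by (simp_all add: sp_def amp_def)
      moreover have "travel y = travel x + sp y * (y - x)"
        unfolding travel_def \<open>sp y = sp x\<close> *(1,2)[OF y] by (simp add: algebra_simps)
      ultimately show ?thesis using 1 by simp
    qed
    moreover have "d > 0" using 1 by (simp add: d_def)
    ultimately show ?thesis by blast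
  next
    case 2
    define d where "d = min (off x - A) (2 * pi - A - off x)"
    have *: "cell y = cell x" "off y = off x + (y - x)" "\<not> off y < A" if "\<bar>y - x\<bar> < d" for y
      using same_cell[of x y] that A by (auto simp: d_def)
    have "?P y" if y: "\<bar>y - x\<bar> < d" for y
    proof -
      have "sp y = sp x" "amp y = amp x"
        using *(1,3)[OF y] 2 by (simp_all add: sp_def amp_def)
      moreover have "travel y = travel x + sp y * (y - x)"
        unfolding travel_def \<open>sp y = sp x\<close> *(1,2)[OF y] by (simp add: algebra_simps)
      ultimately show ?thesis using 2 A by simp
    qed
    moreover have "d > 0" using 2 off_bounds[of x] by (simp add: d_def)
    ultimately show ?thesis by blast
  next
    case 3
    define d where "d = min (2 * A) (2 * pi - 2 * A)"
    have *: "cell y = cell x" "off y = A + (y - x)" if "\<bar>y - x\<bar> < d" for y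
      using same_cell[of x y] that A 3 by (auto simp: d_def)
    have "d > 0" using A by (simp add: d_def)
    moreover have "travel y = travel x + sp y * (y - x)" if "\<bar>y - x\<bar> < d" for y
      using *[OF that] 3 by (simp add: travel_def)
    moreover have "(\<sigma> = 1 \<longrightarrow> amp y = amp x) \<and> (\<sigma> = -1 \<longrightarrow> amp y * sp y = amp x * sp x)"
      if "\<bar>y - x\<bar> < d" for y
    proof -
      have "amp y = \<delta> ^ (nat (cell x) + (if y < x then 0 else e))" "sp y = (if y < x then sa else sb)"
        "amp x = \<delta> ^ (nat (cell x) + e)" "sp x = sb"
        using *[OF that] 3 by (simp_all add: amp_def sp_def)
      then show ?thesis
        using jump by (intro conjI impI) (simp_all add: mult.assoc)
    qed
    moreover have "off x \<noteq> - A" using 3 A by simp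
    ultimately show ?thesis using 3 by blast
  next
    case 4
    define d where "d = min (2 * A) (2 * pi - 2 * A)"
    \<comment> \<open>The left end of the central layer is excluded by x > -A, so a previous cell
      with nonnegative index exists and truncation by \<open>nat\<close> does no harm.\<close>
    have n: "cell x \<ge> 1"
    proof -
      have "2 * pi * of_int (cell x) > 0" using 4 x by (simp add: off_def)
      then show ?thesis by (simp add: zero_less_mult_iff)
    qed
    have R: "cell y = cell x" "off y = - A + (y - x)" if "\<bar>y - x\<bar> < d" "y \<ge> x" for y
      using same_cell[of x y] that A 4 by (auto simp: d_def)
    \<comment> \<open>Points just left of an inner layer belong to the end of the previous
      cell.\<close>
    have L: "cell y = cell x - 1" "off y = 2 * pi - A + (y - x)" if "\<bar>y - x\<bar> < d" "y < x" for y
    proof -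
      have eq: "y - 2 * pi * of_int (cell x - 1) = 2 * pi - A + (y - x)"
        using 4 by (simp add: off_def algebra_simps)
      show *: "cell y = cell x - 1"
        by (rule cell_eqI) (unfold eq, use that A in \<open>auto simp: d_def\<close>)
      show "off y = 2 * pi - A + (y - x)"
        unfolding off_def * by (rule eq)
    qed
    have spx: "sp x = sa" using 4 A by (simp add: sp_def)
    have spR: "sp y = sa" if "\<bar>y - x\<bar> < d" "y \<ge> x" for y
      using R[OF that] that A by (auto simp: sp_def d_def)
    have spL: "sp y = sb" if "\<bar>y - x\<bar> < d" "y < x" for y
      using L[OF that] that A by (auto simp: sp_def d_def)
    have "d > 0" using A by (simp add: d_def)
    moreover have "travel y = travel x + sp y * (y - x)" if y: "\<bar>y - x\<bar> < d" for y
    proof (cases "y < x")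
      case True
      show ?thesis
        unfolding travel_def spL[OF y True] spx L[OF y True] 4 period_time_def by (simp add: algebra_simps)
    next
      case False
      then have "y \<ge> x" by simp
      then show ?thesis
        unfolding travel_def spR[OF y \<open>y \<ge> x\<close>] spx R[OF y \<open>y \<ge> x\<close>] 4 by (simp add: algebra_simps)
    qed
    moreover have "(\<sigma> = -1 \<longrightarrow> amp y = amp x) \<and> (\<sigma> = 1 \<longrightarrow> amp y * sp y = amp x * sp x)"
      if y: "\<bar>y - x\<bar> < d" for y
    proof (cases "y < x")
      case True
      have Suc: "nat (cell x) = Suc (nat (cell x - 1))" using n by simp
      have "amp y = \<delta> ^ (nat (cell x - 1) + e)"
        using spL[OF y True] L[OF y True] True y A by (auto simp: amp_def d_def)
      moreover have "amp x = \<delta> ^ nat (cell x)" using 4 A by (simp add: amp_def)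
      ultimately show ?thesis
        using Suc jump by (intro conjI impI) (simp_all add: spL[OF y True] spx)
    next
      case False
      then have "y \<ge> x" by simp
      have "amp y = amp x" "sp y = sp x"
        using R[OF y \<open>y \<ge> x\<close>] y A 4 spR[OF y \<open>y \<ge> x\<close>] spx by (auto simp: amp_def d_def)
      then show ?thesis by (intro conjI impI) (simp_all only:)
    qed
    moreover have "off x \<noteq> A" using 4 A by simp
    ultimately show ?thesis using 4 by blast
  qed
qed

lemma sp_bounds: "0 < sp x" "\<bar>sp x\<bar> \<le> max sa sb"
  using sa sb by (auto simp: sp_def)

lemma amp_bounds: "0 \<le> amp x" "amp x \<le> 1"
  using delta by (auto simp: amp_def power_le_one)

lemma isCont_travel:
  assumes "x > - A"
  shows "isCont travel x"
proof -
  obtain d where d: "d > 0" "\<And>y. \<bar>y - x\<bar> < d \<Longrightarrow> travel y = travel x + sp y * (y - x)"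
    using local_structure[OF assms] by blast
  have "((\<lambda>y. travel y - travel x) \<longlongrightarrow> 0) (at x)"
  proof (rule tendsto_0_le[where K = "max sa sb"])
    show "((\<lambda>y. y - x) \<longlongrightarrow> 0) (at x)" by (intro tendsto_eq_intros) auto
    have "\<forall>\<^sub>F y in at x. \<bar>y - x\<bar> < d"
      using d(1) by (auto simp: eventually_at dist_real_def)
    then show "\<forall>\<^sub>F y in at x. norm (travel y - travel x) \<le> norm (y - x) * max sa sb"
    proof eventually_elim
      case (elim y)
      show ?case
        using mult_left_mono[OF sp_bounds(2)[of y], of "\<bar>y - x\<bar>"]
        by (simp add: d(2)[OF elim] abs_mult mult.commute)
    qed
  qed
  then show ?thesis by (simp add: isCont_def LIM_zero_iff)
qed

text \<open>One factor \<open>\<delta>\<close> is gained per period, and at least x/(2 pi) - 1 of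
  them have been collected at x; the prefactor 1/\<delta> pays for the unfinished period.\<close>

lemma amp_decay:
  assumes "x \<ge> 0"
  shows "amp x \<le> (1 / \<delta>) * exp (- (- ln \<delta> / (2 * pi)) * x)"
proof -
  define n where "n = nat (cell x)"
  have "x / (2 * pi) \<le> real n + 1"
  proof -
    have "(x + A) / (2 * pi) < of_int (cell x) + 1" unfolding cell_def by linarith
    moreover have "x / (2 * pi) \<le> (x + A) / (2 * pi)" using A by (intro divide_right_mono) auto
    moreover have "of_int (cell x) = real n" using cell_nonneg[of x] assms A by (simp add: n_def)
    ultimately show ?thesis by linarith
  qed
  then have le: "(real n + 1) * ln \<delta> \<le> (x / (2 * pi)) * ln \<delta>"
    using delta by (intro mult_right_mono_neg) auto
  have "amp x \<le> \<delta> ^ n"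
    unfolding amp_def n_def using delta by (intro power_decreasing) auto
  also have "\<dots> = exp (real n * ln \<delta>)" using delta by (simp add: exp_of_nat_mult)
  also have "\<dots> = (1 / \<delta>) * exp ((real n + 1) * ln \<delta>)"
    using delta by (simp add: distrib_right exp_add)
  also have "\<dots> \<le> (1 / \<delta>) * exp ((x / (2 * pi)) * ln \<delta>)"
    using le delta by (intro mult_left_mono) auto
  finally show ?thesis by (simp add: mult.commute)
qed

text \<open>The origin lies inside a layer, but |x| has a kink there and the delta sits
  there.\<close>

definition interfaces :: "real set" where
  "interfaces = {x. x = 0 \<or> off \<bar>x\<bar> = A \<or> off \<bar>x\<bar> = - A}"

lemma finite_interfaces: "finite (interfaces \<inter> {-r..r})"
proof -
  define I where "I = {0..\<lceil>r\<rceil> + 1}"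
  define F where "F n = {2 * pi * of_int n + A, - (2 * pi * of_int n + A), 2 * pi * of_int n - A, - (2 * pi * of_int n - A)}" for n :: int
  have "interfaces \<inter> {-r..r} \<subseteq> insert 0 (\<Union>n\<in>I. F n)"
  proof
    fix x assume x: "x \<in> interfaces \<inter> {-r..r}"
    show "x \<in> insert 0 (\<Union>n\<in>I. F n)"
    proof (cases "x = 0")
      case False
      define n where "n = cell \<bar>x\<bar>"
      have o: "\<bar>x\<bar> - 2 * pi * of_int n = A \<or> \<bar>x\<bar> - 2 * pi * of_int n = - A"
        using x False by (auto simp: interfaces_def off_def n_def)
      then have "2 * pi * of_int n \<le> \<bar>x\<bar> + A" using A by linarith
      then have "2 * pi * of_int n \<le> 2 * pi * (r + 1)"
      proof -
        have "\<bar>x\<bar> \<le> r" using x by auto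
        moreover from this have "1 * r \<le> (2 * pi) * r" using pi_gt3 by (intro mult_right_mono) auto
        ultimately show ?thesis using \<open>2 * pi * of_int n \<le> \<bar>x\<bar> + A\<close> A pi_gt_zero
          by (simp add: distrib_left)
      qed
      then have "of_int n \<le> r + 1" by simp
      then have "n \<le> \<lceil>r\<rceil> + 1" by linarith
      moreover have "n \<ge> 0" unfolding n_def using A by (intro cell_nonneg) linarith
      ultimately have "n \<in> I" by (simp add: I_def)
      moreover have "x \<in> F n" using o by (auto simp: F_def abs_if split: if_splits)
      ultimately show ?thesis by blast
    qed simp
  qed
  moreover have "finite (insert 0 (\<Union>n\<in>I. F n))" by (simp add: I_def F_def)
  ultimately show ?thesis by (rule finite_subset)
qed

lemma locally_affine_even:
  assumes "x \<notin> interfaces"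
  shows "\<exists>d>0. \<forall>y. \<bar>y - x\<bar> < d \<longrightarrow> amp \<bar>y\<bar> = amp \<bar>x\<bar> \<and> sp \<bar>y\<bar> = sp \<bar>x\<bar> \<and>
    travel \<bar>y\<bar> = travel \<bar>x\<bar> + sgn x * sp \<bar>x\<bar> * (y - x)"
proof -
  have x: "x \<noteq> 0" "off \<bar>x\<bar> \<noteq> A" "off \<bar>x\<bar> \<noteq> - A" using assms by (auto simp: interfaces_def)
  have "\<bar>x\<bar> > - A" using A by linarith
  from local_structure[OF this] x
  have "\<exists>d>0. \<forall>y. \<bar>y - \<bar>x\<bar>\<bar> < d \<longrightarrow>
      travel y = travel \<bar>x\<bar> + sp y * (y - \<bar>x\<bar>) \<and> sp y = sp \<bar>x\<bar> \<and> amp y = amp \<bar>x\<bar>"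
    by simp
  then obtain d where d: "d > 0"
    "\<And>y. \<bar>y - \<bar>x\<bar>\<bar> < d \<Longrightarrow> travel y = travel \<bar>x\<bar> + sp y * (y - \<bar>x\<bar>) \<and> sp y = sp \<bar>x\<bar> \<and> amp y = amp \<bar>x\<bar>"
    by blast
  have "amp \<bar>y\<bar> = amp \<bar>x\<bar> \<and> sp \<bar>y\<bar> = sp \<bar>x\<bar> \<and>
      travel \<bar>y\<bar> = travel \<bar>x\<bar> + sgn x * sp \<bar>x\<bar> * (y - x)" if "\<bar>y - x\<bar> < min d \<bar>x\<bar>" for y
  proof -
    have eq: "\<bar>y\<bar> - \<bar>x\<bar> = sgn x * (y - x)" using that x(1) by (auto simp: sgn_if abs_if split: if_splits)
    have "\<bar>\<bar>y\<bar> - \<bar>x\<bar>\<bar> < d" using that abs_triangle_ineq3[of y x] by linarith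
    from d(2)[OF this] have *: "travel \<bar>y\<bar> = travel \<bar>x\<bar> + sp \<bar>y\<bar> * (\<bar>y\<bar> - \<bar>x\<bar>)" "sp \<bar>y\<bar> = sp \<bar>x\<bar>" "amp \<bar>y\<bar> = amp \<bar>x\<bar>"
      by blast+
    show ?thesis unfolding *(1) eq *(2,3) by (simp add: mult.commute mult.left_commute)
  qed
  moreover have "min d \<bar>x\<bar> > 0" using d(1) x(1) by simp
  ultimately show ?thesis by blast
qed

text \<open>\<open>symA\<close> concerns right ends of inner layers, \<open>symB\<close> left ends.
  For \<open>\<sigma>\<close> = 1 the flux profile vanishes at right ends and the wave profile at
  left ends; for \<open>\<sigma>\<close> = -1 the roles are exchanged. Each coefficient jumps only
  where its own profile vanishes.\<close>

lemma continuous_standing_wave: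
  fixes f :: "real \<Rightarrow> real"
  assumes f: "continuous_on UNIV f"
    and symA: "\<And>t n. f (t - of_int n * period_time) = f (t + of_int n * period_time)"
    and symB: "\<And>t n. f (t - (of_int n * period_time - 2 * sa * A)) = - f (t + (of_int n * period_time - 2 * sa * A))"
  shows "continuous_on UNIV (\<lambda>z. amp \<bar>fst z\<bar> * (f (snd z - travel \<bar>fst z\<bar>) + \<sigma> * f (snd z + travel \<bar>fst z\<bar>)))"
    and "continuous_on UNIV (\<lambda>z. amp \<bar>fst z\<bar> * sp \<bar>fst z\<bar> * (- f (snd z - travel \<bar>fst z\<bar>) + \<sigma> * f (snd z + travel \<bar>fst z\<bar>)))"
proof -
  \<comment> \<open>c = 1 gives the profile of the wave, c = -1 that of the flux.\<close>
  have W: "continuous_on UNIV (\<lambda>z. c * f (snd z - fst z) + \<sigma> * f (snd z + fst z))" for c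
    by (intro continuous_intros continuous_on_compose2[OF f]) auto
  have even: "continuous_on UNIV (\<lambda>z. H (\<bar>fst z\<bar>, snd z))"
    if "\<And>x t. x \<ge> 0 \<Longrightarrow> isCont H (x, t)" for H :: "real \<times> real \<Rightarrow> real"
    unfolding continuous_on_eq_continuous_at[OF open_UNIV]
  proof
    fix z :: "real \<times> real"
    have "isCont (\<lambda>z::real \<times> real. (\<bar>fst z\<bar>, snd z)) z" by (intro continuous_intros)
    then show "isCont (\<lambda>z. H (\<bar>fst z\<bar>, snd z)) z"
      by (rule isCont_o2) (use that in simp)
  qed
  have trav: "off x = A \<Longrightarrow> travel x = of_int (cell x) * period_time"
    "off x = - A \<Longrightarrow> travel x = of_int (cell x) * period_time - 2 * sa * A" for x
    using A by (auto simp: travel_def sp_def algebra_simps)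
  have near: "\<forall>\<^sub>F y in nhds x. \<bar>y - x\<bar> < d" if "d > 0" for x d :: real
    using that eventually_nhds_metric dist_real_def by metis
  have "isCont (\<lambda>z. amp (fst z) * (1 * f (snd z - travel (fst z)) + \<sigma> * f (snd z + travel (fst z)))) (x, t)"
    if x: "x \<ge> 0" for x t
  proof -
    have "x > - A" using x A by simp
    from local_structure[OF this] obtain d where d: "d > 0"
      "\<And>y. \<bar>y - x\<bar> < d \<Longrightarrow> (off x \<noteq> A \<and> off x \<noteq> - A \<longrightarrow> amp y = amp x) \<and>
         (off x = A \<longrightarrow> \<sigma> = 1 \<longrightarrow> amp y = amp x) \<and> (off x = - A \<longrightarrow> \<sigma> = -1 \<longrightarrow> amp y = amp x)"
      by blast
    have "isCont (\<lambda>z. amp (fst z) * (\<lambda>z. 1 * f (snd z - fst z) + \<sigma> * f (snd z + fst z)) (travel (fst z), snd z)) (x, t)"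
    proof (rule isCont_amplitude_times_profile[OF isCont_travel[OF \<open>x > - A\<close>] _ W])
      show "\<bar>amp y\<bar> \<le> 1" for y using amp_bounds[of y] by simp
      consider "off x = A" "\<sigma> = - 1" | "off x = - A" "\<sigma> = 1" | "off x = A" "\<sigma> = 1" | "off x = - A" "\<sigma> = -1"
        | "off x \<noteq> A \<and> off x \<noteq> - A" using sigma by blast
      then show "(\<forall>\<^sub>F y in nhds x. amp y = amp x) \<or>
         (\<forall>t. (\<lambda>z. 1 * f (snd z - fst z) + \<sigma> * f (snd z + fst z)) (travel x, t) = 0)"
      proof cases
        case 1
        have "1 * f (t - travel x) + \<sigma> * f (t + travel x) = 0" for t
          unfolding trav(1)[OF 1(1)] symA 1(2) by simp
        then show ?thesis by simp
      next
        case 2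
        have "1 * f (t - travel x) + \<sigma> * f (t + travel x) = 0" for t
          unfolding trav(2)[OF 2(1)] symB 2(2) by simp
        then show ?thesis by simp
      qed (rule disjI1, rule eventually_mono[OF near[OF d(1)]], use d(2) in blast)+
    qed
    then show ?thesis by simp
  qed
  from even[OF this] show "continuous_on UNIV (\<lambda>z. amp \<bar>fst z\<bar> * (f (snd z - travel \<bar>fst z\<bar>) + \<sigma> * f (snd z + travel \<bar>fst z\<bar>)))"
    by simp
  have "isCont (\<lambda>z. (amp (fst z) * sp (fst z)) * (-1 * f (snd z - travel (fst z)) + \<sigma> * f (snd z + travel (fst z)))) (x, t)"
    if x: "x \<ge> 0" for x t
  proof -
    have "x > - A" using x A by simp
    from local_structure[OF this] obtain d where d: "d > 0"
      "\<And>y. \<bar>y - x\<bar> < d \<Longrightarrow> (off x \<noteq> A \<and> off x \<noteq> - A \<longrightarrow> sp y = sp x \<and> amp y = amp x) \<and>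
         (off x = A \<longrightarrow> \<sigma> = -1 \<longrightarrow> amp y * sp y = amp x * sp x) \<and> (off x = - A \<longrightarrow> \<sigma> = 1 \<longrightarrow> amp y * sp y = amp x * sp x)"
      by blast
    have "isCont (\<lambda>z. (amp (fst z) * sp (fst z)) * (\<lambda>z. -1 * f (snd z - fst z) + \<sigma> * f (snd z + fst z)) (travel (fst z), snd z)) (x, t)"
    proof (rule isCont_amplitude_times_profile[OF isCont_travel[OF \<open>x > - A\<close>] _ W, where f = "\<lambda>x. amp x * sp x"])
      show "\<bar>amp y * sp y\<bar> \<le> 1 * max sa sb" for y
        unfolding abs_mult using amp_bounds[of y] sp_bounds[of y] by (intro mult_mono) auto
      consider "off x = A" "\<sigma> = 1" | "off x = - A" "\<sigma> = - 1" | "off x = A" "\<sigma> = - 1" | "off x = - A" "\<sigma> = 1"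
        | "off x \<noteq> A \<and> off x \<noteq> - A" using sigma by blast
      then show "(\<forall>\<^sub>F y in nhds x. amp y * sp y = amp x * sp x) \<or>
         (\<forall>t. (\<lambda>z. -1 * f (snd z - fst z) + \<sigma> * f (snd z + fst z)) (travel x, t) = 0)"
      proof cases
        case 1
        have "-1 * f (t - travel x) + \<sigma> * f (t + travel x) = 0" for t
          unfolding trav(1)[OF 1(1)] symA 1(2) by simp
        then show ?thesis by simp
      next
        case 2
        have "-1 * f (t - travel x) + \<sigma> * f (t + travel x) = 0" for t
          unfolding trav(2)[OF 2(1)] symB 2(2) by simp
        then show ?thesis by simp
      next
        case 5
        have "amp y * sp y = amp x * sp x" if "\<bar>y - x\<bar> < d" for y
          using d(2)[OF that] 5 by (elim conjE) (simp only: simp_thms)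
        then show ?thesis by (intro disjI1 eventually_mono[OF near[OF d(1)]])
      qed (rule disjI1, rule eventually_mono[OF near[OF d(1)]], use d(2) in blast)+
    qed
    then show ?thesis by simp
  qed
  from even[OF this] show "continuous_on UNIV (\<lambda>z. amp \<bar>fst z\<bar> * sp \<bar>fst z\<bar> * (- f (snd z - travel \<bar>fst z\<bar>) + \<sigma> * f (snd z + travel \<bar>fst z\<bar>)))"
    by simp
qed

text \<open>The data are prescribed on the line x = 0 and continued outwards. The relation between
  \<open>\<gamma>\<close> and \<open>\<kappa>\<close> is the jump condition at 0, where the flux
  comes out as - \<sigma> sa v(t + 2 sa A).\<close>

theorem wave_exists:
  fixes u v g :: "real \<Rightarrow> real" and h hb :: int and m :: nat
  assumes Q: "Q > 0" and T: "T = 4 * real m * Q" and m: "m > 0"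
    and cv: "continuous_on UNIV v" and du: "\<And>t. (u has_real_derivative v t) (at t)"
    and anti: "\<And>t. v (t + 2 * Q) = - v t" "\<And>t. u (t + 2 * Q) = - u t"
    and bd: "\<And>t. \<bar>v t\<bar> \<le> B" "\<And>t. \<bar>u t\<bar> \<le> B"
    and h: "2 * sa * A = (2 * of_int h + 1) * Q" and hb: "2 * sb * (pi - A) = (2 * of_int hb + 1) * Q"
    and dv: "\<And>t. ((\<lambda>t. v t ^ 3) has_real_derivative \<kappa> * v (t + 2 * sa * A)) (at t)"
    and \<kappa>: "\<gamma> * \<kappa> = - 2 * \<sigma> * sa"
    and g: "countable N" "\<And>x. x \<notin> N \<Longrightarrow> g x = (sp \<bar>x\<bar>)\<^sup>2"
  shows "\<exists>w. continuous_on UNIV w \<and> weak_solution T g \<gamma> w \<and> (\<forall>t. w (0, t) = u t) \<and>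
    (\<exists>C \<rho>. C > 0 \<and> \<rho> > 0 \<and> (\<forall>x t. \<bar>w (x, t)\<bar> \<le> C * exp (- \<rho> * \<bar>x\<bar>)))"
proof -
  define \<tau> where "\<tau> = sa * A"
  \<comment> \<open>Chosen so that the trace at 0 is \<open>u\<close>. The phase there is -\<tau>,
    and the terms u(t + 2\<tau>) and u(t - 2\<tau>) cancel because 4\<tau> is an odd multiple of
    2Q.\<close>
  define U V where "U t = (u (t - \<tau>) + \<sigma> * u (t + \<tau>)) / 2" and "V t = (v (t - \<tau>) + \<sigma> * v (t + \<tau>)) / 2" for t
  have \<sigma>: "\<bar>\<sigma>\<bar> = 1" "\<sigma> * \<sigma> = 1" using sigma by auto
  have dU: "(U has_real_derivative V t) (at t)" for t
  proof -
    have "((\<lambda>t. u (t - \<tau>)) has_real_derivative v (t - \<tau>)) (at t)"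
      using DERIV_shift[THEN iffD1, OF du[of "t + - \<tau>"]] by simp
    moreover have "((\<lambda>t. u (t + \<tau>)) has_real_derivative v (t + \<tau>)) (at t)"
      by (rule DERIV_shift[THEN iffD1, OF du])
    ultimately show ?thesis
      unfolding U_def V_def by (intro DERIV_cdivide DERIV_add DERIV_cmult)
  qed
  have cV: "continuous_on UNIV V"
    unfolding V_def by (intro continuous_intros continuous_on_compose2[OF cv]) auto
  have cU: "continuous_on UNIV U"
    by (rule DERIV_continuous_on[of _ U V]) (simp add: dU)
  have shift: "(t + 2 * Q) - \<tau> = (t - \<tau>) + 2 * Q" "(t + 2 * Q) + \<tau> = (t + \<tau>) + 2 * Q" for t
    by simp_all
  have antiU: "U (t + 2 * Q) = - U t" and antiV: "V (t + 2 * Q) = - V t" for t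
    unfolding U_def V_def shift anti by (simp_all add: field_simps)
  have bdUV: "\<bar>(x + \<sigma> * y) / 2\<bar> \<le> B" if "\<bar>x\<bar> \<le> B" "\<bar>y\<bar> \<le> B" for x y
    using that abs_triangle_ineq[of x "\<sigma> * y"] by (simp add: abs_mult \<sigma>)
  \<comment> \<open>The two odd crossing times add up to an even multiple of Q, so twice any
    multiple of \<open>period_time\<close> is a multiple of 4Q.\<close>
  have P: "period_time = 2 * of_int (h + hb + 1) * Q"
    unfolding period_time_def h hb by (simp add: algebra_simps)
  have symA: "f (t - of_int n * period_time) = f (t + of_int n * period_time)"
    if "\<And>t. f (t + 2 * Q) = - f t" for f :: "real \<Rightarrow> real" and t and n :: int
  proof -
    have "t + of_int n * period_time = (t - of_int n * period_time) + 4 * of_int (n * (h + hb + 1)) * Q"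
      unfolding P by (simp add: algebra_simps)
    then show ?thesis
      using antiperiodic_shift(1)[of f Q, OF that] by (simp only:)
  qed
  have symB: "f (t - (of_int n * period_time - 2 * sa * A)) = - f (t + (of_int n * period_time - 2 * sa * A))"
    if "\<And>t. f (t + 2 * Q) = - f t" for f :: "real \<Rightarrow> real" and t and n :: int
  proof -
    define r where "r = t - (of_int n * period_time - 2 * sa * A)"
    \<comment> \<open>Subtracting twice the odd crossing time leaves the residue 2 modulo 4, hence
      the change of sign.\<close>
    have eq: "t + (of_int n * period_time - 2 * sa * A)
       = r + (4 * of_int (n * (h + hb + 1) - h - 1) + 2) * Q"
      unfolding r_def P h by (simp add: algebra_simps)
    have "f (r + (4 * of_int (n * (h + hb + 1) - h - 1) + 2) * Q) = - f r"
      by (rule antiperiodic_shift(2)[of f Q, OF that])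
    then show ?thesis unfolding eq r_def[symmetric] by (simp only: minus_minus)
  qed
  have per: "f (t + T) = f t" if "\<And>t. f (t + 2 * Q) = - f t" for f :: "real \<Rightarrow> real" and t
    using antiperiodic_shift(1)[of f Q t "int m", OF that] unfolding T by (simp only: of_int_of_nat_eq)
  interpret lw: layered_wave T "\<lambda>x. sp \<bar>x\<bar>" "\<lambda>x. travel \<bar>x\<bar>" "\<lambda>x. amp \<bar>x\<bar>" U V \<sigma> "1 / \<delta>"
    "- ln \<delta> / (2 * pi)" "max B (max sa sb)" interfaces
  proof
    show "T > 0" using T m Q by simp
    show "\<bar>U t\<bar> \<le> max B (max sa sb)" for t using bdUV[OF bd(2) bd(2)] unfolding U_def by (simp add: le_max_iff_disj)
    show "\<bar>V t\<bar> \<le> max B (max sa sb)" for t using bdUV[OF bd(1) bd(1)] unfolding V_def by (simp add: le_max_iff_disj)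
    show "\<bar>sp \<bar>x\<bar>\<bar> \<le> max B (max sa sb)" for x using sp_bounds(2)[of "\<bar>x\<bar>"] by (auto simp: le_max_iff_disj)
    show "- ln \<delta> / (2 * pi) > 0" using delta by (simp add: divide_neg_pos)
    show "\<bar>amp \<bar>x\<bar>\<bar> \<le> 1 / \<delta> * exp (- (- ln \<delta> / (2 * pi)) * \<bar>x\<bar>)" for x
      using amp_decay[of "\<bar>x\<bar>"] amp_bounds(1)[of "\<bar>x\<bar>"] by simp
    show "0 \<in> interfaces" by (simp add: interfaces_def)
    show "continuous_on UNIV (\<lambda>z. amp \<bar>fst z\<bar> * (U (snd z - travel \<bar>fst z\<bar>) + \<sigma> * U (snd z + travel \<bar>fst z\<bar>)))"
      by (rule continuous_standing_wave(1)[OF cU symA[of U, OF antiU] symB[of U, OF antiU]])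
    show "continuous_on UNIV (\<lambda>z. amp \<bar>fst z\<bar> * sp \<bar>fst z\<bar> * (- V (snd z - travel \<bar>fst z\<bar>) + \<sigma> * V (snd z + travel \<bar>fst z\<bar>)))"
      by (rule continuous_standing_wave(2)[OF cV symA[of V, OF antiV] symB[of V, OF antiV]])
  qed (rule dU cV per[of U, OF antiU] per[of V, OF antiV] \<sigma>(1) finite_interfaces locally_affine_even, assumption?)+
  have "cell 0 = 0" by (rule cell_eqI) (use A in auto)
  then have zero: "off 0 = 0" "sp 0 = sa" "amp 0 = 1" "travel 0 = - \<tau>"
    using A by (auto simp: off_def sp_def amp_def travel_def \<tau>_def)
  \<comment> \<open>The left end of the central layer (n = 0) gives the phase relation needed at the
    origin.\<close>
  have half_turn: "f (t - 2 * \<tau>) = - f (t + 2 * \<tau>)" if "\<And>t. f (t + 2 * Q) = - f t" for f :: "real \<Rightarrow> real" and t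
    using symB[of f, OF that, of t 0] unfolding \<tau>_def by (simp add: mult.assoc)
  have sum: "(f (t + \<tau> - \<tau>) + \<sigma> * f (t + \<tau> + \<tau>)) / 2 + \<sigma> * ((f (t - \<tau> - \<tau>) + \<sigma> * f (t - \<tau> + \<tau>)) / 2) = f t"
    and dif: "- ((f (t + \<tau> - \<tau>) + \<sigma> * f (t + \<tau> + \<tau>)) / 2) + \<sigma> * ((f (t - \<tau> - \<tau>) + \<sigma> * f (t - \<tau> + \<tau>)) / 2) = - \<sigma> * f (t + 2 * \<tau>)"
    if f: "\<And>t. f (t + 2 * Q) = - f t" for f :: "real \<Rightarrow> real" and t
  proof -
    have eq: "t + \<tau> - \<tau> = t" "t - \<tau> + \<tau> = t" "t + \<tau> + \<tau> = t + 2 * \<tau>" "t - \<tau> - \<tau> = t - 2 * \<tau>" by simp_all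
    have "\<sigma> * (\<sigma> * f t) = f t" using \<sigma>(2) by (simp add: mult.assoc[symmetric])
    then show "(f (t + \<tau> - \<tau>) + \<sigma> * f (t + \<tau> + \<tau>)) / 2 + \<sigma> * ((f (t - \<tau> - \<tau>) + \<sigma> * f (t - \<tau> + \<tau>)) / 2) = f t"
      "- ((f (t + \<tau> - \<tau>) + \<sigma> * f (t + \<tau> + \<tau>)) / 2) + \<sigma> * ((f (t - \<tau> - \<tau>) + \<sigma> * f (t - \<tau> + \<tau>)) / 2) = - \<sigma> * f (t + 2 * \<tau>)"
      unfolding eq half_turn[of f, OF f] by (simp_all add: field_simps)
  qed
  have w0: "lw.w (0, t) = u t" for t
    using sum[of u, OF anti(2), of t] unfolding lw.w_def fst_conv snd_conv abs_zero zero U_def by simp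
  have wt0: "lw.wt (0, t) = v t" for t
    using sum[of v, OF anti(1), of t] unfolding lw.wt_def fst_conv snd_conv abs_zero zero V_def by simp
  have flux0: "lw.flux (0, t) = sa * (- \<sigma> * v (t + 2 * \<tau>))" for t
    using dif[of v, OF anti(1), of t] unfolding lw.flux_def fst_conv snd_conv abs_zero zero V_def by simp
  have "weak_solution T g \<gamma> lw.w"
  proof (rule lw.weak_solution_w[OF g])
    fix t
    have "((\<lambda>t. \<gamma> * v t ^ 3) has_real_derivative \<gamma> * (\<kappa> * v (t + 2 * sa * A))) (at t)"
      by (rule DERIV_cmult[OF dv])
    moreover have "\<gamma> * (\<kappa> * v (t + 2 * sa * A)) = 2 * lw.flux (0, t)"
      unfolding flux0 \<tau>_def using \<kappa> by (simp add: mult.assoc[symmetric])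
    ultimately show "((\<lambda>t. \<gamma> * lw.wt (0, t) ^ 3) has_real_derivative 2 * lw.flux (0, t)) (at t)"
      unfolding wt0 by simp
  qed
  moreover have "\<exists>C \<rho>. C > 0 \<and> \<rho> > 0 \<and> (\<forall>x t. \<bar>lw.w (x, t)\<bar> \<le> C * exp (- \<rho> * \<bar>x\<bar>))"
  proof (rule lw.exponential_decay)
    fix C assume C: "C > 0" "\<And>z. \<bar>lw.w z\<bar> \<le> C * exp (- (- ln \<delta> / (2 * pi)) * \<bar>fst z\<bar>)"
    have "\<bar>lw.w (x, t)\<bar> \<le> C * exp (- (- ln \<delta> / (2 * pi)) * \<bar>x\<bar>)" for x t
      using C(2)[of "(x, t)"] by (simp only: fst_conv)
    then show ?thesis using C(1) lw.decay(1) by blast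
  qed
  ultimately show ?thesis
    using lw.continuous_w[of UNIV] w0 by blast
qed

end

lemma (in step_medium) periodic_step_eq_speed:
  assumes per: "\<And>x. g (x + 2 * pi) = g x"
    and ga: "\<And>x. \<bar>x\<bar> < A \<Longrightarrow> g x = sa\<^sup>2"
    and gb: "\<And>x. A < \<bar>x\<bar> \<Longrightarrow> \<bar>x\<bar> < pi \<Longrightarrow> g x = sb\<^sup>2"
  shows "\<exists>N. countable N \<and> (\<forall>x. x \<notin> N \<longrightarrow> g x = (sp \<bar>x\<bar>)\<^sup>2)"
proof -
  \<comment> \<open>Besides the interfaces this contains the odd multiples of pi, where g is not
    prescribed.\<close>
  define N where "N = (\<Union>n::int. \<Union>y\<in>{A, -A, pi}. {2 * pi * of_int n + y, - (2 * pi * of_int n + y)})"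
  have "g x = (sp \<bar>x\<bar>)\<^sup>2" if x: "x \<notin> N" for x
  proof -
    define n y where "n = cell \<bar>x\<bar>" and "y = off \<bar>x\<bar>"
    have absx: "\<bar>x\<bar> = 2 * pi * of_int n + y" by (simp add: n_def y_def off_def)
    have y: "- A \<le> y" "y < 2 * pi - A" unfolding y_def by (rule off_bounds)+
    have "y \<notin> {A, -A, pi}"
    proof
      assume "y \<in> {A, -A, pi}"
      moreover have "x = 2 * pi * of_int n + y \<or> x = - (2 * pi * of_int n + y)" using absx by linarith
      ultimately have "x \<in> N" unfolding N_def by blast
      then show False using x by simp
    qed
    then have y': "y \<noteq> A" "y \<noteq> -A" "y \<noteq> pi" by auto
    \<comment> \<open>g is prescribed on both sides of 0 through |x|, so negative points are
      reflected and then translated into the basic period.\<close>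
    define \<epsilon> :: real where "\<epsilon> = (if x \<ge> 0 then 1 else -1)"
    have shift: "g x = g (\<epsilon> * (y - 2 * pi * of_int k))" for k :: int
    proof (cases "x \<ge> 0")
      case True
      then have "x = (y - 2 * pi * of_int k) + of_int (n + k) * (2 * pi)"
        using absx by (simp add: algebra_simps)
      then show ?thesis using periodic_int_shift[of g "2 * pi", OF per] True unfolding \<epsilon>_def by (metis mult_1)
    next
      case False
      then have "x = - (y - 2 * pi * of_int k) + of_int (- n - k) * (2 * pi)"
        using absx by (simp add: algebra_simps)
      then show ?thesis using periodic_int_shift[of g "2 * pi", OF per] False unfolding \<epsilon>_def by (metis mult_minus1)
    qed
    have abs_eps: "\<bar>\<epsilon> * z\<bar> = \<bar>z\<bar>" for z by (simp add: \<epsilon>_def)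
    consider "y < A" | "A < y" "y < pi" | "pi < y" using y' by linarith
    then show ?thesis
    proof cases
      case 1
      have "g x = sa\<^sup>2" unfolding shift[of 0] by (rule ga) (use 1 y y' in \<open>simp add: abs_eps\<close>)
      then show ?thesis using 1 by (simp add: sp_def y_def)
    next
      case 2
      have "g x = sb\<^sup>2" unfolding shift[of 0] by (rule gb) (use 2 A in \<open>simp_all add: abs_eps\<close>)
      then show ?thesis using 2 by (simp add: sp_def y_def)
    next
      case 3
      \<comment> \<open>Offsets run up to 2 pi - A; those beyond pi are moved back by one period
        into the range where g is given.\<close>
      have "g x = sb\<^sup>2" unfolding shift[of 1] by (rule gb) (use 3 y A in \<open>simp_all add: abs_eps\<close>)
      then show ?thesis using 3 A by (simp add: sp_def y_def)
    qed
  qed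
  moreover have "countable N" unfolding N_def by simp
  ultimately show ?thesis by blast
qed

theorem theorem1p2:
  fixes a b \<Theta> \<gamma> \<omega> :: real and g :: "real \<Rightarrow> real"
    and p q p' q' :: nat
  assumes "a > 0" and "b > 0" and "a \<noteq> b"
    and "0 < \<Theta>" and "\<Theta> < 1"
    and "\<forall>x. g (x + 2 * pi) = g x"
    and "\<forall>x. \<bar>x\<bar> < pi * \<Theta> \<longrightarrow> g x = a"
    and "\<forall>x. pi * \<Theta> < \<bar>x\<bar> \<and> \<bar>x\<bar> < pi \<longrightarrow> g x = b"
    and "odd p'" and "odd q'"
    and "sqrt (b / a) * ((1 - \<Theta>) / \<Theta>) = real p' / real q'"
    and "\<gamma> \<noteq> 0"
    and "\<omega> > 0"
    and "odd p" and "odd q"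
    and "4 * sqrt a * \<Theta> * \<omega> = real p / real q"
  shows "\<exists>W :: nat \<Rightarrow> (real \<times> real \<Rightarrow> real).
     (\<forall>n. weak_solution (2 * pi / \<omega>) g \<gamma> (W n)
          \<and> \<not> ae_eqD (2 * pi / \<omega>) (W n) (\<lambda>_. 0)
          \<and> (\<exists>C \<rho>. C > 0 \<and> \<rho> > 0 \<and> (\<forall>x t. \<bar>W n (x, t)\<bar> \<le> C * exp (- \<rho> * \<bar>x\<bar>))))
     \<and> (\<forall>m n. m \<noteq> n \<longrightarrow> \<not> ae_eqD (2 * pi / \<omega>) (W m) (W n))"
proof -
  define T where "T = 2 * pi / \<omega>"
  define sa sb A where "sa = sqrt a" and "sb = sqrt b" and "A = pi * \<Theta>"
  define \<sigma> :: real where "\<sigma> = (if b < a then 1 else -1)"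
  have pos: "p > 0" "q > 0" "p' > 0" "q' > 0" using assms by (auto intro: odd_pos)
  interpret step_medium sa sb A \<sigma>
  proof
    show "sa > 0" "sb > 0" "0 < A" "A < pi" using assms by (simp_all add: sa_def sb_def A_def)
    show "\<sigma> = 1 \<and> sb < sa \<or> \<sigma> = - 1 \<and> sa < sb" using assms by (auto simp: \<sigma>_def sa_def sb_def)
  qed
  obtain N where N: "countable N" "\<And>x. x \<notin> N \<Longrightarrow> g x = (sp \<bar>x\<bar>)\<^sup>2"
    using periodic_step_eq_speed[of g] assms unfolding A_def sa_def sb_def by auto
  \<comment> \<open>Solves the jump condition at 0 for the coefficient of the delay
    equation.\<close>
  define \<kappa> where "\<kappa> = - 2 * \<sigma> * sa / \<gamma>"
  have \<kappa>0: "\<bar>\<kappa>\<bar> > 0" using sa \<open>\<gamma> \<noteq> 0\<close> by (simp add: \<kappa>_def \<sigma>_def)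
  have \<gamma>\<kappa>: "\<gamma> * \<kappa> = - 2 * \<sigma> * sa" using \<open>\<gamma> \<noteq> 0\<close> by (simp add: \<kappa>_def)
  have T: "T > 0" using \<open>\<omega> > 0\<close> by (simp add: T_def)
  \<comment> \<open>The residue of the inner crossing time in units of \<open>Q n\<close>: 1
    reproduces v(t + Q), while 3 reproduces its negative and so handles \<kappa> < 0.\<close>
  define d :: nat where "d = (if \<kappa> > 0 then 1 else 3)"
  \<comment> \<open>The square of the odd number p q' is 1 modulo 4, so p q' j is congruent to d.
    Steps of 4 keep both this residue and the oddness of j.\<close>
  define j where "j n = p * q' * d + 4 * n" for n
  \<comment> \<open>The factor q q' clears the denominators of both crossing times.\<close>
  define M where "M n = q * q' * j n" for n
  define Q where "Q n = T / (4 * real (M n))" for n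
  have dpos: "d > 0" by (simp add: d_def)
  have jpos: "j n > 0" for n using pos dpos by (simp add: j_def)
  have Mpos: "M n > 0" for n using pos jpos by (simp add: M_def)
  have Qpos: "Q n > 0" for n using T Mpos by (simp add: Q_def)
  have TQ: "T = 4 * real (M n) * Q n" for n using Mpos[of n] by (simp add: Q_def)
  have ta: "2 * sa * A = real (p * q' * j n) * Q n" for n
  proof -
    have "2 * sa * A = (4 * sqrt a * \<Theta> * \<omega>) * (2 * pi / (4 * \<omega>))"
      using \<open>\<omega> > 0\<close> by (simp add: sa_def A_def)
    also have "\<dots> = (real p / real q) * (T / 4)" by (simp only: assms T_def) simp
    also have "\<dots> = real (p * q' * j n) * Q n"
      using pos jpos[of n] by (simp add: Q_def M_def)
    finally show ?thesis .
  qed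
  have tb: "2 * sb * (pi - A) = real (p * p' * j n) * Q n" for n
  proof -
    have "2 * sb * (pi - A) = (2 * sa * A) * (sqrt (b / a) * ((1 - \<Theta>) / \<Theta>))"
      using assms(1,2,4) by (simp add: sa_def sb_def A_def real_sqrt_divide field_simps)
    also have "\<dots> = (real (p * q' * j n) * Q n) * (real p' / real q')" by (simp only: ta[of n] assms)
    also have "\<dots> = real (p * p' * j n) * Q n" using pos by simp
    finally show ?thesis .
  qed
  have oddj: "odd (j n)" for n using assms by (simp add: j_def d_def)
  have kmod: "\<exists>h. p * q' * j n = 4 * h + d" for n
  proof -
    obtain y where y: "p * q' = 2 * y + 1" using assms by (metis even_mult_iff oddE)
    have "p * q' * j n = 4 * ((y * y + y) * d + n * (p * q')) + d"
      unfolding j_def y by (simp add: algebra_simps)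
    then show ?thesis by blast
  qed
  obtain c where c: "c > 0" and osc: "\<And>Q. Q > 0 \<Longrightarrow> \<exists>u v B. continuous_on UNIV v \<and>
      (\<forall>t. ((\<lambda>t. v t ^ 3) has_real_derivative \<bar>\<kappa>\<bar> * v (t + Q)) (at t)) \<and>
      (\<forall>t. (u has_real_derivative v t) (at t)) \<and>
      (\<forall>t. v (t + 2 * Q) = - v t) \<and> (\<forall>t. u (t + 2 * Q) = - u t) \<and> (\<forall>t. \<bar>v t\<bar> \<le> B) \<and>
      (\<forall>t. \<bar>u t\<bar> \<le> c * sqrt Q ^ 3) \<and> u (2 * Q) = c * sqrt Q ^ 3"
    by (rule scaled_oscillator[OF \<kappa>0]) (rule that, assumption+)
  have "\<exists>w. continuous_on UNIV w \<and> weak_solution T g \<gamma> w \<and>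
    (\<exists>C \<rho>. C > 0 \<and> \<rho> > 0 \<and> (\<forall>x t. \<bar>w (x, t)\<bar> \<le> C * exp (- \<rho> * \<bar>x\<bar>))) \<and>
    (\<forall>t. \<bar>w (0, t)\<bar> \<le> c * sqrt (Q n) ^ 3) \<and> w (0, 2 * Q n) = c * sqrt (Q n) ^ 3" for n
  proof -
    from osc[OF Qpos[of n]] obtain u v B where uv: "continuous_on UNIV v"
      "\<And>t. ((\<lambda>t. v t ^ 3) has_real_derivative \<bar>\<kappa>\<bar> * v (t + Q n)) (at t)"
      "\<And>t. (u has_real_derivative v t) (at t)"
      "\<And>t. v (t + 2 * Q n) = - v t" "\<And>t. u (t + 2 * Q n) = - u t" "\<And>t. \<bar>v t\<bar> \<le> B"
      "\<And>t. \<bar>u t\<bar> \<le> c * sqrt (Q n) ^ 3" "u (2 * Q n) = c * sqrt (Q n) ^ 3"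
      by blast
    obtain h where h: "p * q' * j n = 4 * h + d" using kmod by blast
    have dv: "((\<lambda>t. v t ^ 3) has_real_derivative \<kappa> * v (t + 2 * sa * A)) (at t)" for t
    proof -
      have "\<kappa> * v (t + 2 * sa * A) = \<bar>\<kappa>\<bar> * v (t + Q n)"
      proof (cases "\<kappa> > 0")
        case True
        have "t + 2 * sa * A = (t + Q n) + 4 * of_int (int h) * Q n"
          unfolding ta[of n] h using True by (simp add: d_def algebra_simps)
        then show ?thesis
          using antiperiodic_shift(1)[of v "Q n", OF uv(4)] True by (simp only: abs_of_pos)
      next
        case False
        have "t + 2 * sa * A = (t + Q n) + (4 * of_int (int h) + 2) * Q n"
          unfolding ta[of n] h using False by (simp add: d_def algebra_simps)
        then have "v (t + 2 * sa * A) = - v (t + Q n)"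
          using antiperiodic_shift(2)[of v "Q n", OF uv(4)] by (simp only:)
        then show ?thesis using False by simp
      qed
      then show ?thesis using uv(2)[of t] by simp
    qed
    have "odd (p * q' * j n)" "odd (p * p' * j n)" using assms oddj by auto
    then obtain h1 h2 where h12: "p * q' * j n = 2 * h1 + 1" "p * p' * j n = 2 * h2 + 1" by (meson oddE)
    have "\<exists>w. continuous_on UNIV w \<and> weak_solution T g \<gamma> w \<and> (\<forall>t. w (0, t) = u t) \<and>
      (\<exists>C \<rho>. C > 0 \<and> \<rho> > 0 \<and> (\<forall>x t. \<bar>w (x, t)\<bar> \<le> C * exp (- \<rho> * \<bar>x\<bar>)))"
    proof (rule wave_exists[where B = "max B (c * sqrt (Q n) ^ 3)" and h = "int h1" and hb = "int h2"])
      show "2 * sa * A = (2 * of_int (int h1) + 1) * Q n" unfolding ta[of n] h12 by simp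
      show "2 * sb * (pi - A) = (2 * of_int (int h2) + 1) * Q n" unfolding tb[of n] h12 by simp
      show "\<bar>v t\<bar> \<le> max B (c * sqrt (Q n) ^ 3)" "\<bar>u t\<bar> \<le> max B (c * sqrt (Q n) ^ 3)" for t
        using uv(6)[of t] uv(7)[of t] by linarith+
    qed (rule Qpos TQ Mpos uv(1) uv(3) uv(4) uv(5) dv \<gamma>\<kappa> N, assumption?)+
    then show ?thesis using uv(7,8) by metis
  qed
  then have "\<exists>W. \<forall>n. continuous_on UNIV (W n) \<and> weak_solution T g \<gamma> (W n) \<and>
    (\<exists>C \<rho>. C > 0 \<and> \<rho> > 0 \<and> (\<forall>x t. \<bar>W n (x, t)\<bar> \<le> C * exp (- \<rho> * \<bar>x\<bar>))) \<and>
    (\<forall>t. \<bar>W n (0, t)\<bar> \<le> c * sqrt (Q n) ^ 3) \<and> W n (0, 2 * Q n) = c * sqrt (Q n) ^ 3"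
    by (intro choice allI)
  then obtain W where cont: "\<And>n. continuous_on UNIV (W n)" and sol: "\<And>n. weak_solution T g \<gamma> (W n)"
    and dec: "\<And>n. \<exists>C \<rho>. C > 0 \<and> \<rho> > 0 \<and> (\<forall>x t. \<bar>W n (x, t)\<bar> \<le> C * exp (- \<rho> * \<bar>x\<bar>))"
    and le: "\<And>n t. \<bar>W n (0, t)\<bar> \<le> c * sqrt (Q n) ^ 3" and top: "\<And>n. W n (0, 2 * Q n) = c * sqrt (Q n) ^ 3"
    by blast
  \<comment> \<open>The time 2Q at which the trace is maximal must lie strictly inside (0, T) for
    pointwise comparison to apply.\<close>
  have Qin: "0 < 2 * Q n" "2 * Q n < T" for n
  proof -
    have "real (M n) \<ge> 1" using Mpos[of n] by simp
    then have "T \<ge> 4 * Q n" using TQ[of n] Qpos[of n] mult_right_mono[of 1 "real (M n)" "Q n"] by linarith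
    then show "0 < 2 * Q n" "2 * Q n < T" using Qpos[of n] by linarith+
  qed
  have "\<not> ae_eqD T (W n) (\<lambda>_. 0)" for n
  proof
    assume "ae_eqD T (W n) (\<lambda>_. 0)"
    then have "W n (0, 2 * Q n) = 0"
      by (rule continuous_AE_eq_Dset[OF cont continuous_on_const _ Qin])
    then show False using top[of n] c Qpos[of n] by simp
  qed
  moreover have "\<not> ae_eqD T (W m) (W n)" if "m \<noteq> n" for m n
  proof
    assume ae: "ae_eqD T (W m) (W n)"
    \<comment> \<open>Each trace attains its maximum at its own time, and the other trace would have
      to match it there. The two maxima thus bound each other and coincide, which forces equal
      \<open>Q\<close> and equal indices.\<close>
    have "W m (0, 2 * Q m) = W n (0, 2 * Q m)" "W m (0, 2 * Q n) = W n (0, 2 * Q n)"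
      by (rule continuous_AE_eq_Dset[OF cont cont ae Qin])+
    then have "c * sqrt (Q m) ^ 3 = c * sqrt (Q n) ^ 3"
      using top[of m] top[of n] le[of n "2 * Q m"] le[of m "2 * Q n"] by linarith
    then have "sqrt (Q m) = sqrt (Q n)"
      using c Qpos[of m] Qpos[of n] by (simp add: power_eq_iff_eq_base)
    then have "Q m = Q n" by simp
    then have "M m = M n" using T Mpos[of m] Mpos[of n] by (simp add: Q_def)
    then show False using pos \<open>m \<noteq> n\<close> by (simp add: M_def j_def)
  qed
  ultimately show ?thesis
    using sol dec unfolding T_def by (intro exI[of _ W]) blast
qed

end
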